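(* Let $k$ and $\ell$ be positive integers and write $m:=2^{\mathrm{ord}_2(\gcd(k,\ell))}$. Suppose that $q:=2^k$ and $Q:=2^\ell$ satisfy $\gcd(Q-1,q+1)=1$. Write $A(X):=1+bX+aX^v+dX^u$ where $a,b,d\in\mathbb{F}_{q^2}$ and $u,v$ are positive integers such that $u(Q-1)\equiv q\pmod{q+1}$ and $v(Q-1)\equiv Q\pmod{q+1}$. Then $f(X):=XA(X^{q-1})$ permutes $\mathbb{F}_{q^2}$ if and only if all of the following hold: (1) $e:=1+a^{q+1}+b^{q+1}+d^{q+1}$ is nonzero; (2) $(ab^q+d^q)^Q=e^{Q-1}(a+bd^q)$; (3) $\mathrm{Tr}_{\mathbb{F}_q/\mathbb{F}_{2^m}}\Bigl(\frac{a^{q+1}+d^{q+1}}{e}\Bigr)=0$.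
   Context: For a positive integer $n$, $\mathrm{ord}_2(n)$ is the largest integer $i\ge0$ with $2^i\mid n$. A polynomial permutes $\mathbb{F}_{q^2}$ if it induces a bijection of $\mathbb{F}_{q^2}$. $\mathrm{Tr}_{\mathbb{F}_q/\mathbb{F}_{2^m}}$ is the trace map (note $m\mid k$). *)

theory Defs
  imports
    "HOL-Number_Theory.Number_Theory"
    "HOL-Computational_Algebra.Computational_Algebra"
    "HOL-Library.Cardinality"
begin

definition permutation_poly :: "'a::finite_field poly \<Rightarrow> bool" where
  "permutation_poly f \<longleftrightarrow> bij (poly f)"

text \<open>
  The trace map from the field with \<open>r ^ n\<close> elements to its subfield with \<open>r\<close> elements, as the
  sum of the \<open>n\<close> Galois conjugates. Both fields are regarded as subfields of the type \<open>'a\<close>: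
  the field with \<open>s\<close> elements is the set of all \<open>x\<close> with \<open>x ^ s = x\<close>. The value is
  meaningful only for arguments \<open>x\<close> with \<open>x ^ (r ^ n) = x\<close>.
\<close>
definition finite_field_trace :: "nat \<Rightarrow> nat \<Rightarrow> 'a::finite_field \<Rightarrow> 'a" where
  "finite_field_trace r n x = (\<Sum>i<n. x ^ (r ^ i))"

end

theory Submission
  imports Defs
begin

text \<open>
  Write \<open>cj x = x ^ q\<close>, \<open>fr x = x ^ Q\<close>, and let \<open>mu\<close> be the group of \<open>(q + 1)\<close>-st roots of unity.
  Substituting \<open>x ^ (q - 1) = s ^ (Q - 1)\<close> turns the question into whether
  \<open>num / den\<close>, a quotient of two polynomials \<open>\<alpha> s ^ (Q + 1) + \<beta> s ^ Q + \<gamma> s + \<delta>\<close>, permutes \<open>mu\<close>.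
  Writing a second point as \<open>y (s + 1) / s\<close> with \<open>cj s = s + 1\<close>, a coincidence of values becomes an
  equation in \<open>s\<close> whose coefficients are the quadratics \<open>pA (y ^ Q)\<close> and \<open>pB y\<close>.

  Necessity of (1) and (2): every root \<open>r\<close> of \<open>pB\<close> in the big field satisfies \<open>pA (r ^ Q) = 0\<close>.
  If \<open>r\<close> lies in \<open>mu\<close>, the equation would otherwise be solvable by extracting a \<open>Q\<close>-th root. If not,
  degree-one substitutions moving \<open>r\<close> to \<open>0\<close> bring the map into the form
  \<open>y (\<tau> y ^ Q + \<sigma>) / (cj \<tau> + cj \<sigma> y ^ Q)\<close>, and the vanishing of the sum of its values
  over \<open>mu\<close> gives \<open>\<tau> = 0\<close> or \<open>\<sigma> = 0\<close>.

  Given (1) and (2), the substitution \<open>w = (pB y s / y + h y) / e\<close> makes the equation independent of \<open>y\<close>: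
  it becomes \<open>w ^ Q + w = n / e\<close> with \<open>w ^ q = w + 1\<close>, and (3) says exactly that this has no solution.
\<close>

subsection \<open>A field of characteristic two with a subfield of index two\<close>

locale binary_tower =
  fixes k l :: nat and fld :: "'a::finite_field itself"
  assumes k_pos: "k > 0" and card_fld: "CARD('a) = (2 ^ k) ^ 2"
begin

definition cj :: "'a \<Rightarrow> 'a" where "cj x = x ^ (2 ^ k)"
definition fr :: "'a \<Rightarrow> 'a" where "fr x = x ^ (2 ^ l)"
definition mu :: "'a set" where "mu = {x. x * cj x = 1}"

section \<open>Arithmetic in characteristic two, with the conjugation \<open>cj\<close> and the
  Frobenius power \<open>fr\<close>\<close>

lemma char_2: "CHAR('a) = 2"
proof -
  have "CHAR('a) dvd 2 ^ (k * 2)"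
    using CHAR_dvd_CARD[where 'a = 'a] by (simp add: card_fld power_mult)
  then show ?thesis
    by (metis CHAR_prime prime_dvd_power two_is_prime_nat primes_dvd_imp_eq)
qed

lemma two_eq_0 [simp]: "(2::'a) = 0"
  using of_nat_CHAR[where 'a = 'a] by (simp add: char_2)

lemma add_self [simp]: "x + x = (0::'a)"
  by (metis mult_2 mult_zero_left two_eq_0)

lemma add_left_self [simp]: "x + (x + y) = (y::'a)"
  by (simp flip: add.assoc)

lemma uminus_eq [simp]: "- x = (x::'a)"
  by (simp add: minus_unique)

lemma diff_eq_add [simp]: "x - y = x + (y::'a)"
  using diff_conv_add_uminus[of x y] by simp

lemma add_eq_0_iff_eq: "x + y = 0 \<longleftrightarrow> x = (y::'a)"
  by (simp flip: diff_eq_add del: diff_eq_add)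

lemma power_two_power_add: "(x + y) ^ (2 ^ n) = x ^ (2 ^ n) + (y::'a) ^ (2 ^ n)"
  by (rule freshmans_dream') (simp_all add: char_2)

lemma power_two_power_sum: "sum f A ^ (2 ^ n) = (\<Sum>i\<in>A. (f i :: 'a) ^ (2 ^ n))"
  by (rule freshmans_dream_sum') (simp_all add: char_2)

lemma cj_add [simp]: "cj (x + y) = cj x + cj y"
  by (simp add: cj_def power_two_power_add)
lemma cj_mult [simp]: "cj (x * y) = cj x * cj y"
  by (simp add: cj_def power_mult_distrib)
lemma cj_power [simp]: "cj (x ^ n) = cj x ^ n"
  by (simp add: cj_def flip: power_mult) (simp add: mult.commute)
lemma cj_divide [simp]: "cj (x / y) = cj x / cj y"
  by (simp add: cj_def power_divide)
lemma cj_0 [simp]: "cj 0 = 0"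
  by (simp add: cj_def)
lemma cj_1 [simp]: "cj 1 = 1"
  by (simp add: cj_def)
lemma cj_cj [simp]: "cj (cj x) = x"
  using finite_field_power_card_eq_same[of x]
  by (simp add: cj_def card_fld power2_eq_square power_mult)
lemma cj_eq_0_iff [simp]: "cj x = 0 \<longleftrightarrow> x = 0"
  by (simp add: cj_def)

lemma fr_add [simp]: "fr (x + y) = fr x + fr y"
  by (simp add: fr_def power_two_power_add)
lemma fr_mult [simp]: "fr (x * y) = fr x * fr y"
  by (simp add: fr_def power_mult_distrib)
lemma fr_power [simp]: "fr (x ^ n) = fr x ^ n"
  by (simp add: fr_def flip: power_mult) (simp add: mult.commute)
lemma fr_divide [simp]: "fr (x / y) = fr x / fr y"
  by (simp add: fr_def power_divide)
lemma fr_0 [simp]: "fr 0 = 0"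
  by (simp add: fr_def)
lemma fr_1 [simp]: "fr 1 = 1"
  by (simp add: fr_def)
lemma fr_cj [simp]: "fr (cj x) = cj (fr x)"
  by (simp add: fr_def)
lemma fr_eq_0_iff [simp]: "fr x = 0 \<longleftrightarrow> x = 0"
  by (simp add: fr_def)

lemma fr_eq_iff [simp]: "fr x = fr y \<longleftrightarrow> x = y"
proof -
  have "fr (x + y) = 0 \<longleftrightarrow> x + y = 0"
    by (rule fr_eq_0_iff)
  then show ?thesis
    by (simp add: add_eq_0_iff_eq del: fr_eq_0_iff)
qed

lemma fr_surj: obtains y where "fr y = x"
  using finite_UNIV_inj_surj[of fr] by (metis fr_eq_iff finite_class.finite_UNIV injI surjD)

lemma square_surj: obtains y :: 'a where "y ^ 2 = x"
proof -
  have "inj (\<lambda>y::'a. y ^ 2)"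
  proof (rule injI)
    fix x y :: 'a
    assume "x ^ 2 = y ^ 2"
    then have "(x + y) ^ 2 = 0"
      using power_two_power_add[of x y 1] by simp
    then show "x = y"
      by (simp add: add_eq_0_iff_eq)
  qed
  then show ?thesis
    using that finite_UNIV_inj_surj[of "\<lambda>y::'a. y ^ 2"] by (metis finite_class.finite_UNIV surjD)
qed

lemma square_add: "(x + y) ^ 2 = x ^ 2 + (y::'a) ^ 2"
  using power_two_power_add[of x y 1] by simp

section \<open>The group of roots of unity \<open>mu\<close>\<close>

lemma mu_1 [simp]: "1 \<in> mu"
  by (simp add: mu_def)
lemma mu_nonzero: "x \<in> mu \<Longrightarrow> x \<noteq> 0"
  by (auto simp: mu_def)
lemma mu_cj: "x \<in> mu \<Longrightarrow> cj x = 1 / x"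
  using mu_nonzero[of x] by (simp add: mu_def nonzero_eq_divide_eq mult.commute)
lemma mu_mult: "x \<in> mu \<Longrightarrow> y \<in> mu \<Longrightarrow> x * y \<in> mu"
  unfolding mu_def by simp (metis mult.assoc mult.left_commute mult_1_right)
lemma mu_divide: "x \<in> mu \<Longrightarrow> y \<in> mu \<Longrightarrow> x / y \<in> mu"
  using mu_mult[of x "cj y"] by (simp add: mu_cj mu_nonzero) (simp add: mu_def mult.commute)
lemma mu_iff: "x \<in> mu \<longleftrightarrow> x ^ (2 ^ k + 1) = 1"
  by (simp add: mu_def cj_def)
lemma mu_power: "x \<in> mu \<Longrightarrow> x ^ n \<in> mu"
  by (simp add: mu_def flip: power_mult_distrib)
lemma mu_power_cong:
  assumes "x \<in> mu" "[i = j] (mod (2 ^ k + 1))"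
  shows "x ^ i = x ^ j"
proof -
  have "x ^ i = x ^ (i mod (2 ^ k + 1))" for i
  proof -
    have "x ^ i = (x ^ (2 ^ k + 1)) ^ (i div (2 ^ k + 1)) * x ^ (i mod (2 ^ k + 1))"
      by (metis mult_div_mod_eq power_add power_mult)
    with assms(1) show ?thesis
      by (simp only: mu_iff power_one mult_1)
  qed
  then show ?thesis
    using assms(2) by (metis cong_def)
qed

lemma power_roots_bound:
  fixes c :: 'a
  assumes "n > 0"
  shows "card {x. x ^ n = c} \<le> n"
proof -
  have "card {x. poly (monom 1 n - [:c:]) x = 0} \<le> degree (monom 1 n - [:c:])"
  proof (rule card_poly_roots_bound)
    show "monom 1 n - [:c:] \<noteq> 0"
    proof
      assume "monom 1 n - [:c:] = 0"
      then have "coeff (monom 1 n - [:c:]) n = 0"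
        by simp
      with assms show False
        by (simp add: coeff_pCons split: nat.splits)
    qed
  qed
  also have "degree (monom 1 n - [:c:]) \<le> n"
    by (intro degree_diff_le degree_monom_le) simp_all
  finally show ?thesis
    by (simp add: poly_monom add_eq_0_iff_eq)
qed

lemma power_not_all_1:
  assumes "0 < n" "n < (2 ^ k) ^ 2 - 1"
  obtains x :: 'a where "x \<noteq> 0" "x ^ n \<noteq> 1"
proof -
  have "\<not> UNIV - {0::'a} \<subseteq> {x. x ^ n = 1}"
  proof
    assume "UNIV - {0::'a} \<subseteq> {x. x ^ n = 1}"
    then have "card (UNIV - {0::'a}) \<le> card {x::'a. x ^ n = 1}"
      by (intro card_mono) auto
    also have "\<dots> \<le> n"
      using assms by (intro power_roots_bound) auto
    also have "card (UNIV - {0::'a}) = (2 ^ k) ^ 2 - 1"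
      by (simp add: card_Diff_singleton card_fld)
    finally show False
      using assms by simp
  qed
  then show ?thesis
    using that by auto
qed

lemma power_q_minus_1: "x \<noteq> 0 \<Longrightarrow> x ^ (2 ^ k - 1) = cj x / x"
  by (simp add: cj_def power_diff)

lemma ratio_in_mu: "x \<noteq> 0 \<Longrightarrow> x ^ (2 ^ k - 1) \<in> mu"
  using power_q_minus_1[of x] by (simp add: mu_def)

lemma mu_ratioE:
  assumes "y \<in> mu"
  obtains x where "x \<noteq> 0" "x ^ (2 ^ k - 1) = y"
proof (cases "y = 1")
  case True
  then show ?thesis
    using that[of 1] by simp
next
  case False
  have "y \<noteq> 0"
    using assms by (rule mu_nonzero)
  define x where "x = 1 + cj y"
  have "x \<noteq> 0"
    using False by (metis add_eq_0_iff_eq cj_1 cj_cj x_def)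
  moreover have "cj x = y * x"
    using assms \<open>y \<noteq> 0\<close> by (simp add: x_def mu_cj field_simps)
  ultimately show ?thesis
    using that[of x] power_q_minus_1[of x] by simp
qed

text \<open>An element moved by \<open>cj\<close>, divided by its relative trace
  \<open>x + cj x\<close>, has relative trace one.\<close>

lemma half_trace_element:
  obtains w where "cj w = w + 1"
proof -
  have "2 ^ k \<ge> (2::nat)"
    using k_pos by (cases k) auto
  then have "2 ^ k - 1 < (2 ^ k) ^ 2 - (1::nat)"
    by (simp add: power2_eq_square diff_less_mono)
  with \<open>2 ^ k \<ge> 2\<close> obtain x :: 'a where x: "x \<noteq> 0" "x ^ (2 ^ k - 1) \<noteq> 1"
    using power_not_all_1[of "2 ^ k - 1"] by auto
  then have "x + cj x \<noteq> 0"
    using power_q_minus_1[of x] by (auto simp: add_eq_0_iff_eq)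
  then have "cj (x / (x + cj x)) = x / (x + cj x) + 1"
    by (simp add: field_simps)
  then show ?thesis
    by (rule that)
qed

section \<open>Power sums over \<open>mu\<close>\<close>

lemma mu_power_sum_eq_0:
  assumes "0 < j" "j < 2 ^ k + 1"
  shows "(\<Sum>x\<in>mu. x ^ j) = 0"
proof -
  have q: "2 ^ k > (1::nat)"
    using k_pos by (intro one_less_power) simp_all
  have eq: "(2 ^ k) ^ 2 - 1 = (2 ^ k - 1) * (2 ^ k + 1 :: nat)"
    by (simp add: power2_eq_square algebra_simps)
  have "(2 ^ k - 1) * j < (2 ^ k) ^ 2 - 1"
    unfolding eq using assms q by (intro mult_strict_left_mono) auto
  moreover have "(2 ^ k - 1) * j > 0"
    using assms q by simp
  ultimately obtain x :: 'a where x: "x \<noteq> 0" "x ^ ((2 ^ k - 1) * j) \<noteq> 1"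
    using power_not_all_1 by blast
  \<comment> \<open>Multiplication by \<open>z\<close> permutes \<open>mu\<close> and scales the
    power sum by \<open>z ^ j\<close>, which differs from one.\<close>
  define z where "z = x ^ (2 ^ k - 1)"
  have z: "z \<in> mu" "z ^ j \<noteq> 1"
    using x ratio_in_mu[of x] by (simp_all add: z_def power_mult)
  have "(\<Sum>x\<in>mu. x ^ j) = (\<Sum>x\<in>mu. (z * x) ^ j)"
    by (rule sum.reindex_bij_witness[of _ "\<lambda>x. z * x" "\<lambda>x. cj z * x"])
      (use z(1) in \<open>simp_all add: mu_mult mu_divide mu_cj mu_nonzero\<close>)
  also have "\<dots> = z ^ j * (\<Sum>x\<in>mu. x ^ j)"
    by (simp add: power_mult_distrib sum_distrib_left)
  finally have "(1 + z ^ j) * (\<Sum>x\<in>mu. x ^ j) = 0"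
    by (simp add: algebra_simps add_eq_0_iff_eq)
  with z(2) show ?thesis
    by (auto simp: add_eq_0_iff_eq)
qed

text \<open>Adding the power sums for all exponents from \<open>1\<close> to
  \<open>2 ^ k + 1\<close> changes nothing, as the smaller exponents contribute zero. After swapping
  the sums, each \<open>x\<close> contributes a geometric series, which is the indicator of
  \<open>x = 1\<close> because the number of terms is odd.\<close>

lemma mu_power_sum_full: "(\<Sum>x\<in>mu. x ^ (2 ^ k + 1)) = 1"
proof -
  have geo: "(\<Sum>j\<in>{..2 ^ k}. x ^ Suc j) = (if x = 1 then 1 else 0)" if "x \<in> mu" for x
  proof (cases "x = 1")
    case True
    then show ?thesis
      using k_pos by (simp add: two_eq_0 power_0_left)
  next
    case False
    have "(1 - x) * (\<Sum>j\<le>2 ^ k. x ^ j) = 1 - x ^ Suc (2 ^ k)"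
      by (rule sum_gp_basic)
    also have "\<dots> = 0"
      using that by (simp add: mu_iff)
    finally have "(\<Sum>j\<le>2 ^ k. x ^ j) = 0"
      using False by (simp add: add_eq_0_iff_eq)
    then show ?thesis
      using False by (simp flip: sum_distrib_left)
  qed
  have "(\<Sum>x\<in>mu. x ^ (2 ^ k + 1)) = (\<Sum>j\<in>{..2 ^ k}. \<Sum>x\<in>mu. x ^ Suc j)"
  proof -
    have "(\<Sum>j\<in>{..2 ^ k}. \<Sum>x\<in>mu. x ^ Suc j) = (\<Sum>j\<in>{2 ^ k}. \<Sum>x\<in>mu. x ^ Suc j)"
      by (rule sum.mono_neutral_right) (auto intro!: mu_power_sum_eq_0 simp del: power_Suc)
    then show ?thesis
      by simp
  qed
  also have "\<dots> = (\<Sum>x\<in>mu. \<Sum>j\<in>{..2 ^ k}. x ^ Suc j)"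
    by (rule sum.swap)
  also have "\<dots> = (\<Sum>x\<in>mu. if x = 1 then 1 else 0)"
    by (intro sum.cong refl geo)
  also have "\<dots> = 1"
    by (subst sum.delta) simp_all
  finally show ?thesis .
qed

lemma mu_power_sum:
  assumes "0 < j" "j < 2 * (2 ^ k + 1)"
  shows "(\<Sum>x\<in>mu. x ^ j) = (if j = 2 ^ k + 1 then 1 else 0)"
proof -
  consider "j < 2 ^ k + 1" | "j = 2 ^ k + 1" | "2 ^ k + 1 < j"
    by linarith
  then show ?thesis
  proof cases
    case 3
    have "(\<Sum>x\<in>mu. x ^ j) = (\<Sum>x\<in>mu. x ^ (j - (2 ^ k + 1)))"
      using 3 by (intro sum.cong refl mu_power_cong) (auto simp: cong_def le_mod_geq)
    also have "\<dots> = 0"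
      using 3 assms by (intro mu_power_sum_eq_0) auto
    finally show ?thesis
      using 3 by simp
  qed (use assms mu_power_sum_eq_0 mu_power_sum_full in auto)
qed

lemma mu_other:
  obtains y where "y \<in> mu" "y \<noteq> x"
proof -
  obtain w where w: "cj w = w + 1"
    by (rule half_trace_element)
  then have "w \<noteq> 0" "w + 1 \<noteq> 0"
    by (auto simp: add_eq_0_iff_eq)
  then have "(w + 1) / w \<in> mu" "(w + 1) / w \<noteq> 1"
    using w by (auto simp: mu_def)
  with that show ?thesis
    by (metis mu_1)
qed

section \<open>Degree-one maps of \<open>mu\<close> and a power sum criterion\<close>

lemma moebius_mu:
  assumes "s * cj s \<noteq> t * cj t" "y \<in> mu"
  shows "cj t * y + cj s \<noteq> 0" and "(s * y + t) / (cj t * y + cj s) \<in> mu"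
proof -
  have y: "y \<noteq> 0" "cj y = 1 / y"
    using assms(2) by (simp_all add: mu_nonzero mu_cj)
  show nz: "cj t * y + cj s \<noteq> 0"
  proof
    assume "cj t * y + cj s = 0"
    then have "cj t * y = cj s"
      by (simp add: add_eq_0_iff_eq)
    moreover from this have "t = s * y"
    proof -
      have "t * cj y = s"
        using arg_cong[OF \<open>cj t * y = cj s\<close>, of cj] by simp
      then have "t * (1 / y) = s"
        unfolding y(2) .
      moreover have "t * (1 / y) * y = t"
        using y(1) by simp
      ultimately show ?thesis
        by simp
    qed
    ultimately show False
      using assms(1) by (auto simp: mult_ac)
  qed
  \<comment> \<open>On \<open>mu\<close>, conjugation exchanges numerator and denominator up to the
    factor \<open>1 / y\<close>, so the quotient has norm one.\<close>
  have conj: "cj (s * y + t) = (cj t * y + cj s) / y"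
    using y by (simp add: field_simps)
  then have "s * y + t \<noteq> 0"
    using nz y by (metis cj_0 divide_eq_0_iff)
  moreover have conj': "cj (cj t * y + cj s) = (s * y + t) / y"
    using y by (simp add: field_simps)
  moreover have "p / r * (r / y / (p / y)) = 1" if "p \<noteq> 0" "r \<noteq> 0" for p r
    using that y(1) by simp
  ultimately show "(s * y + t) / (cj t * y + cj s) \<in> mu"
    using nz by (simp only: mu_def mem_Collect_eq cj_divide conj conj') blast
qed

lemma moebius_inj:
  assumes "s * cj s \<noteq> t * cj t"
  shows "inj_on (\<lambda>y. (s * y + t) / (cj t * y + cj s)) mu"
proof (rule inj_onI)
  fix x y
  assume xy: "x \<in> mu" "y \<in> mu"
    and "(s * x + t) / (cj t * x + cj s) = (s * y + t) / (cj t * y + cj s)"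
  then have "(s * x + t) * (cj t * y + cj s) = (s * y + t) * (cj t * x + cj s)"
    using moebius_mu(1)[OF assms] by (simp add: frac_eq_eq)
  then have "(s * x + t) * (cj t * y + cj s) + (s * y + t) * (cj t * x + cj s) = 0"
    by simp
  moreover have "(s * x + t) * (cj t * y + cj s) + (s * y + t) * (cj t * x + cj s)
      = (s * cj s + t * cj t) * (x + y)"
    by (simp add: algebra_simps)
  ultimately show "x = y"
    using assms by (auto simp: add_eq_0_iff_eq)
qed

lemma singular_kernel:
  fixes p :: 'a
  assumes "p * s + q * r = 0"
  obtains x y where "x \<noteq> 0 \<or> y \<noteq> 0" "p * x + q * y = 0" "r * x + s * y = 0"
proof (cases "p = 0 \<and> q = 0")
  case True
  then show ?thesis
    using that[of s r] that[of 1 0] by (cases "s = 0 \<and> r = 0") (auto simp: mult_ac)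
next
  case False
  then show ?thesis
    using that[of q p] assms by (auto simp: mult_ac add_ac)
qed

text \<open>If \<open>\<tau>\<close> and \<open>\<sigma>\<close> were both nonzero, the sum could be
  evaluated: a power map inverts \<open>z = fr y\<close> on \<open>mu\<close>, a geometric sum turns
  \<open>1 / (\<alpha> + \<beta> * z)\<close> into a polynomial, and the power sums over
  \<open>mu\<close> leave the nonzero value
  \<open>\<alpha> ^ (c - 1) * \<beta> ^ (q - c)\<close>.\<close>

lemma twisted_permutation_sum:
  assumes nz: "\<And>z. z \<in> mu \<Longrightarrow> cj \<tau> + cj \<sigma> * z \<noteq> 0"
    and sum0: "(\<Sum>y\<in>mu. y * (\<tau> * fr y + \<sigma>) / (cj \<tau> + cj \<sigma> * fr y)) = 0"
  shows "\<tau> = 0 \<or> \<sigma> = 0"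
proof (rule ccontr)
  assume "\<not> ?thesis"
  then have ts: "\<tau> \<noteq> 0" "\<sigma> \<noteq> 0"
    by auto
  define q :: nat where "q = 2 ^ k"
  have "coprime ((2::nat) ^ l) (q + 1)"
    using k_pos unfolding q_def by (intro coprime_power_left_iff[THEN iffD2] disjI1) simp
  then obtain c0 where c0: "[2 ^ l * c0 = Suc 0] (mod (q + 1))"
    using cong_solve_coprime_nat by blast
  \<comment> \<open>Reduction gives \<open>1 \<le> c \<le> q\<close>, which keeps all exponents
    below within the range of \<open>mu_power_sum\<close>.\<close>
  define c where "c = c0 mod (q + 1)"
  have c: "[c * 2 ^ l = 1] (mod (q + 1))"
    using c0 unfolding c_def cong_def by (metis One_nat_def mod_mult_left_eq mult.commute)
  have "c \<noteq> 0"
  proof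
    assume "c = 0"
    with c have "0 mod (q + 1) = 1 mod (q + 1)"
      unfolding cong_def by (simp only: mult_0)
    moreover have "1 mod (q + 1) = 1"
      by (rule mod_less) (simp add: q_def)
    ultimately show False
      by simp
  qed
  have "c \<le> q"
    by (simp add: c_def flip: less_Suc_eq_le)
  define \<alpha> \<beta> where "\<alpha> = cj \<tau>" and "\<beta> = cj \<sigma>"
  have \<alpha>\<beta>: "\<alpha> \<noteq> 0" "\<beta> \<noteq> 0" "cj \<alpha> = \<tau>" "cj \<beta> = \<sigma>"
    using ts by (simp_all add: \<alpha>_def \<beta>_def)
  \<comment> \<open>Otherwise \<open>\<alpha> / \<beta>\<close> would lie in \<open>mu\<close> and
    be a zero of the denominator.\<close>
  have norm: "\<alpha> * \<tau> + \<beta> * \<sigma> \<noteq> 0"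
  proof
    assume "\<alpha> * \<tau> + \<beta> * \<sigma> = 0"
    then have "\<alpha> / \<beta> \<in> mu"
      using \<alpha>\<beta> ts by (simp add: mu_def add_eq_0_iff_eq)
    from nz[OF this] show False
      using \<alpha>\<beta> by (simp flip: \<alpha>_def \<beta>_def)
  qed
  have geo: "(\<alpha> + \<beta> * z) * (\<Sum>i<Suc q. \<alpha> ^ (q - i) * \<beta> ^ i * z ^ i) = \<alpha> * \<tau> + \<beta> * \<sigma>"
    if "z \<in> mu" for z
  proof -
    have "(\<alpha> + \<beta> * z) * (\<Sum>i<Suc q. \<alpha> ^ (q - i) * \<beta> ^ i * z ^ i) = \<alpha> ^ Suc q + (\<beta> * z) ^ Suc q"
      using diff_power_eq_sum[of "\<beta> * z" q \<alpha>]
      by (simp add: power_mult_distrib mult_ac add_ac del: power_Suc sum.lessThan_Suc)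
    also have "\<dots> = \<alpha> * \<tau> + \<beta> * \<sigma>"
      using that \<alpha>\<beta> by (simp add: q_def power_mult_distrib mu_def flip: cj_def)
    finally show ?thesis .
  qed
  have "0 = (\<Sum>y\<in>mu. y * (\<tau> * fr y + \<sigma>) / (\<alpha> + \<beta> * fr y))"
    using sum0 by (simp add: \<alpha>_def \<beta>_def)
  also have "\<dots> = (\<Sum>z\<in>mu. z ^ c * (\<tau> * z + \<sigma>) / (\<alpha> + \<beta> * z))"
  proof (rule sum.reindex_bij_witness[of _ "\<lambda>z. z ^ c" fr])
    have 1: "z ^ (c * 2 ^ l) = z" if "z \<in> mu" for z
      using mu_power_cong[OF that, of "c * 2 ^ l" 1] c by (simp add: q_def)
    fix z assume z: "z \<in> mu"
    show "fr (z ^ c) = z"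
      using 1[OF z] by (simp add: fr_def power_mult)
    show "fr z ^ c = z"
      using 1[OF z] by (simp add: fr_def mult.commute flip: power_mult)
    then show "fr z ^ c * (\<tau> * fr z + \<sigma>) / (\<alpha> + \<beta> * fr z)
        = z * (\<tau> * fr z + \<sigma>) / (\<alpha> + \<beta> * fr z)"
      by simp
    show "z ^ c \<in> mu" "fr z \<in> mu"
      using z by (simp_all add: mu_power fr_def)
  qed
  also have "\<dots> = (\<Sum>z\<in>mu. z ^ c * (\<tau> * z + \<sigma>)
      * (\<Sum>i<Suc q. \<alpha> ^ (q - i) * \<beta> ^ i * z ^ i) / (\<alpha> * \<tau> + \<beta> * \<sigma>))"
  proof (rule sum.cong[OF refl])
    fix z assume "z \<in> mu"
    have "\<alpha> + \<beta> * z \<noteq> 0"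
      using nz[OF \<open>z \<in> mu\<close>] by (simp add: \<alpha>_def \<beta>_def)
    moreover from this have "(\<Sum>i<Suc q. \<alpha> ^ (q - i) * \<beta> ^ i * z ^ i)
        = (\<alpha> * \<tau> + \<beta> * \<sigma>) / (\<alpha> + \<beta> * z)"
      using geo[OF \<open>z \<in> mu\<close>] by (metis nonzero_mult_div_cancel_left)
    ultimately show "z ^ c * (\<tau> * z + \<sigma>) / (\<alpha> + \<beta> * z) = z ^ c * (\<tau> * z + \<sigma>)
      * (\<Sum>i<Suc q. \<alpha> ^ (q - i) * \<beta> ^ i * z ^ i) / (\<alpha> * \<tau> + \<beta> * \<sigma>)"
      using norm by (simp del: sum.lessThan_Suc)
  qed
  also have "\<dots> = (\<Sum>z\<in>mu. \<Sum>i<Suc q. \<alpha> ^ (q - i) * \<beta> ^ i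
      * (\<tau> * z ^ (c + i + 1) + \<sigma> * z ^ (c + i))) / (\<alpha> * \<tau> + \<beta> * \<sigma>)"
    by (simp only: sum_divide_distrib[symmetric] sum_distrib_left)
      (simp add: algebra_simps power_add del: sum.lessThan_Suc)
  also have "(\<Sum>z\<in>mu. \<Sum>i<Suc q. \<alpha> ^ (q - i) * \<beta> ^ i
      * (\<tau> * z ^ (c + i + 1) + \<sigma> * z ^ (c + i)))
    = (\<Sum>i<Suc q. \<alpha> ^ (q - i) * \<beta> ^ i
      * (\<tau> * (\<Sum>z\<in>mu. z ^ (c + i + 1)) + \<sigma> * (\<Sum>z\<in>mu. z ^ (c + i))))"
    by (subst sum.swap) (simp only: sum_distrib_left[symmetric] sum.distrib)
  \<comment> \<open>The exponents lie between \<open>1\<close> and \<open>2 * q + 1\<close>, where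
    only \<open>q + 1\<close> has a nonzero power sum; this selects one index for each of the two
    monomials.\<close>
  also have "\<dots> = (\<Sum>i<Suc q. (if i = q - c then \<alpha> ^ (q - i) * \<beta> ^ i * \<tau> else 0)
      + (if i = Suc q - c then \<alpha> ^ (q - i) * \<beta> ^ i * \<sigma> else 0))"
  proof (rule sum.cong[OF refl])
    fix i assume "i \<in> {..<Suc q}"
    then have i: "i \<le> q" by simp
    have "(\<Sum>z\<in>mu. z ^ (c + i + 1)) = (if i = q - c then 1 else 0)"
      using i \<open>c \<noteq> 0\<close> \<open>c \<le> q\<close> by (subst mu_power_sum) (auto simp: q_def)
    moreover have "(\<Sum>z\<in>mu. z ^ (c + i)) = (if i = Suc q - c then 1 else 0)"
      using i \<open>c \<noteq> 0\<close> \<open>c \<le> q\<close> by (subst mu_power_sum) (auto simp: q_def)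
    ultimately show "\<alpha> ^ (q - i) * \<beta> ^ i
        * (\<tau> * (\<Sum>z\<in>mu. z ^ (c + i + 1)) + \<sigma> * (\<Sum>z\<in>mu. z ^ (c + i)))
      = (if i = q - c then \<alpha> ^ (q - i) * \<beta> ^ i * \<tau> else 0)
      + (if i = Suc q - c then \<alpha> ^ (q - i) * \<beta> ^ i * \<sigma> else 0)"
      by (simp add: algebra_simps)
  qed
  also have "\<dots> = \<alpha> ^ c * \<beta> ^ (q - c) * \<tau> + \<alpha> ^ (c - 1) * \<beta> ^ (Suc q - c) * \<sigma>"
  proof -
    have "q - (Suc q - c) = c - 1"
      using \<open>c \<noteq> 0\<close> \<open>c \<le> q\<close> by auto
    then show ?thesis
      using \<open>c \<noteq> 0\<close> \<open>c \<le> q\<close>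
      by (simp only: sum.distrib sum.delta[OF finite_lessThan]) auto
  qed
  also have "\<dots> = \<alpha> ^ (c - 1) * \<beta> ^ (q - c) * (\<alpha> * \<tau> + \<beta> * \<sigma>)"
  proof -
    have "\<alpha> ^ c = \<alpha> ^ (c - 1) * \<alpha>" "\<beta> ^ (Suc q - c) = \<beta> ^ (q - c) * \<beta>"
      using power_minus_mult[of c \<alpha>] \<open>c \<noteq> 0\<close> \<open>c \<le> q\<close> by (simp_all add: Suc_diff_le)
    then show ?thesis
      by (simp add: algebra_simps)
  qed
  finally show False
    using norm \<alpha>\<beta> by simp
qed

section \<open>Artin-Schreier equations and traces\<close>

lemma artin_schreier_root:
  assumes "cj \<theta> = \<theta>"
  obtains v where "v ^ 2 + v = \<theta>"
proof -
  obtain w where w: "cj w = w + 1"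
    by (rule half_trace_element)
  \<comment> \<open>On \<open>S\<close> the map \<open>\<phi>\<close> is two-to-one with values in \<open>K\<close>, and \<open>card S = 2 * card K\<close>.\<close>
  define K where "K = {x. cj x = x}"
  define S where "S = {x. cj x = x \<or> cj x = x + 1}"
  define \<phi> where "\<phi> x = x ^ 2 + x" for x :: 'a
  have S: "S = K \<union> (\<lambda>x. x + w) ` K"
  proof (rule subset_antisym; rule subsetI)
    fix x assume "x \<in> S"
    then consider "cj x = x" | "cj x = x + 1"
      by (auto simp: S_def)
    then show "x \<in> K \<union> (\<lambda>x. x + w) ` K"
    proof cases
      case 2
      then have "x + w \<in> K" "x = (x + w) + w"
        using w by (simp_all add: K_def add_ac)
      then show ?thesis by blast
    qed (simp add: K_def)
  qed (auto simp: S_def K_def w add_ac)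
  have "card ((\<lambda>x. x + w) ` K) = card K"
    by (rule card_image) simp
  moreover have "K \<inter> (\<lambda>x. x + w) ` K = {}"
    by (auto simp: K_def w)
  ultimately have card_S: "card S = card K + card K"
    unfolding S by (simp add: card_Un_disjoint)
  have sub: "\<phi> ` S \<subseteq> K"
    by (auto simp: S_def K_def \<phi>_def square_add)
  have "card S \<le> (\<Sum>y\<in>\<phi> ` S. card {x \<in> S. \<phi> x = y})"
  proof -
    have "S = (\<Union>y\<in>\<phi> ` S. {x \<in> S. \<phi> x = y})"
      by auto
    then show ?thesis
      using card_UN_le[of "\<phi> ` S" "\<lambda>y. {x \<in> S. \<phi> x = y}"] by simp
  qed
  also have "\<dots> \<le> (\<Sum>y\<in>\<phi> ` S. 2)"
  proof (rule sum_mono)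
    fix y assume "y \<in> \<phi> ` S"
    then obtain x where x: "y = \<phi> x"
      by auto
    have "{x \<in> S. \<phi> x = y} \<subseteq> {x, x + 1}"
    proof
      fix z assume "z \<in> {x \<in> S. \<phi> x = y}"
      then have "\<phi> z = \<phi> x"
        using x by simp
      then have "\<phi> z + \<phi> x = 0"
        by simp
      then have "(z + x) * (z + x + 1) = 0"
        by (simp add: \<phi>_def algebra_simps power2_eq_square)
      then show "z \<in> {x, x + 1}"
        by (auto simp: add_eq_0_iff_eq add.assoc)
    qed
    then have "card {x \<in> S. \<phi> x = y} \<le> card {x, x + 1}"
      by (intro card_mono) auto
    also have "\<dots> \<le> 2"
      by (simp add: card_insert_if)
    finally show "card {x \<in> S. \<phi> x = y} \<le> 2" .
  qed
  finally have "card K \<le> card (\<phi> ` S)"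
    using card_S by simp
  with sub have "\<phi> ` S = K"
    by (intro card_seteq) auto
  moreover have "\<theta> \<in> K"
    using assms by (simp add: K_def)
  ultimately obtain v where "\<theta> = \<phi> v"
    by auto
  then show ?thesis
    using that by (simp add: \<phi>_def)
qed

lemma trace_add:
  "finite_field_trace (2 ^ m) j (x + y) = finite_field_trace (2 ^ m) j x + finite_field_trace (2 ^ m) j (y::'a)"
  by (simp add: finite_field_trace_def power_two_power_add sum.distrib flip: power_mult)

lemma trace_fr: "finite_field_trace (2 ^ m) j (fr x) = fr (finite_field_trace (2 ^ m) j x)"
  by (simp add: finite_field_trace_def fr_def power_two_power_sum flip: power_mult)
    (simp add: mult.commute)

text \<open>Raising to the power \<open>2 ^ m\<close> shifts the sum of conjugates by one index, so
  only its end terms change. For \<open>x\<close> outside the fixed field of \<open>cj\<close> the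
  defect \<open>cj x + x\<close> survives, and \<open>fr_shift_iff_trace\<close> relies on
  it.\<close>

lemma trace_frobenius:
  assumes "k = m * j"
  shows "finite_field_trace (2 ^ m) j x ^ (2 ^ m) = finite_field_trace (2 ^ m) j x + (cj x + x)"
proof -
  have "finite_field_trace (2 ^ m) j x ^ (2 ^ m) = (\<Sum>i<j. x ^ ((2 ^ m) ^ Suc i))"
    by (simp add: finite_field_trace_def power_two_power_sum flip: power_mult)
      (simp add: mult.commute)
  also have "\<dots> + x = finite_field_trace (2 ^ m) j x + cj x"
  proof -
    have "cj x = x ^ ((2 ^ m) ^ j)"
      by (metis cj_def assms power_mult)
    then show ?thesis
      using sum.lessThan_Suc_shift[of "\<lambda>i. x ^ ((2 ^ m) ^ i)" j]
      by (simp add: finite_field_trace_def add.commute)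
  qed
  finally have "finite_field_trace (2 ^ m) j x ^ (2 ^ m) + x = finite_field_trace (2 ^ m) j x + cj x" .
  from arg_cong[OF this, of "\<lambda>y. y + x"] show ?thesis
    by (simp add: add.assoc)
qed

lemma frobenius_shift_iterate:
  fixes x :: 'a
  assumes "x ^ (2 ^ m) = x + c" "c = 0 \<or> c = 1"
  shows "x ^ (2 ^ (m * j)) = x + of_nat j * c"
proof (induction j)
  case (Suc j)
  \<comment> \<open>The value is \<open>0\<close> or \<open>1\<close> by characteristic two, so
    every Frobenius power fixes it.\<close>
  have "of_nat j ^ (2 ^ m) = (of_nat j :: 'a)"
    by (cases "even j") (auto elim!: evenE oddE)
  moreover have "x ^ (2 ^ (m * Suc j)) = (x ^ (2 ^ (m * j))) ^ (2 ^ m)"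
    by (simp add: mult.commute power_add flip: power_mult)
  ultimately show ?case
    using assms unfolding Suc.IH
    by (auto simp: power_two_power_add power_mult_distrib algebra_simps)
qed simp

lemma of_nat_parity: "(of_nat j :: 'a) = (if even j then 0 else 1)"
  by (auto elim!: evenE oddE)

lemma idempotent_cases:
  fixes x :: 'a
  assumes "x ^ 2 + x = 0"
  shows "x = 0 \<or> x = 1"
proof -
  have "x * (x + 1) = 0"
    using assms by (simp add: algebra_simps power2_eq_square)
  then show ?thesis
    by (auto simp: add_eq_0_iff_eq)
qed

text \<open>The trace sum of a \<open>w\<close> with \<open>cj w = w + 1\<close> is shifted by one
  under the power \<open>2 ^ m\<close>, hence also under \<open>fr\<close>, because \<open>i\<close>
  is odd; this gives one direction. For the other, a root \<open>v\<close> of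
  \<open>v ^ 2 + v = \<theta>\<close> satisfies \<open>fr v + v = t\<close> and
  \<open>cj v = v + 1\<close> up to errors \<open>\<delta>\<close> and \<open>\<epsilon>\<close> in
  the prime field, and the trace controls how the two errors combine.\<close>

lemma fr_shift_iff_trace:
  assumes km: "k = m * j" and lm: "l = m * i" "odd i"
    and \<theta>: "cj \<theta> = \<theta>" "t ^ 2 + t = fr \<theta> + \<theta>"
  shows "(\<exists>w. cj w = w + 1 \<and> fr w + w = t) \<longleftrightarrow> finite_field_trace (2 ^ m) j t \<noteq> 0"
proof -
  let ?T = "finite_field_trace (2 ^ m) j"
  have fr_T: "fr (?T w) + ?T w = c" if "cj w = w + c" "c = 0 \<or> c = 1" for w c
  proof -
    have "?T w ^ (2 ^ m) = ?T w + c"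
      using trace_frobenius[OF km, of w] that by (simp add: add_ac)
    moreover have "fr (?T w) = ?T w ^ (2 ^ (m * i))"
      by (metis fr_def lm(1))
    ultimately show ?thesis
      using frobenius_shift_iterate[OF _ that(2), of "?T w" m i] lm(2)
      by (simp add: of_nat_parity add_ac)
  qed
  show ?thesis
  proof
    assume "\<exists>w. cj w = w + 1 \<and> fr w + w = t"
    then obtain w where "cj w = w + 1" "t = fr w + w"
      by auto
    with fr_T[of w 1] show "?T t \<noteq> 0"
      by (simp add: trace_add trace_fr)
  next
    assume T: "?T t \<noteq> 0"
    obtain v where v: "v ^ 2 + v = \<theta>"
      using \<theta>(1) by (rule artin_schreier_root)
    define \<delta> where "\<delta> = t + (fr v + v)"
    define \<epsilon> where "\<epsilon> = cj v + v"
    have "\<delta> ^ 2 + \<delta> = (t ^ 2 + t) + (fr (v ^ 2 + v) + (v ^ 2 + v))"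
      by (simp add: \<delta>_def square_add add_ac)
    also have "\<dots> = 0"
      unfolding v \<theta>(2) by simp
    finally have \<delta>: "\<delta> = 0 \<or> \<delta> = 1"
      by (rule idempotent_cases)
    have "\<epsilon> ^ 2 + \<epsilon> = cj (v ^ 2 + v) + (v ^ 2 + v)"
      by (simp add: \<epsilon>_def square_add add_ac)
    also have "\<dots> = 0"
      unfolding v \<theta>(1) by simp
    finally have \<epsilon>: "\<epsilon> = 0 \<or> \<epsilon> = 1"
      by (rule idempotent_cases)
    have cv: "cj v = v + \<epsilon>"
      by (simp add: \<epsilon>_def add_ac)
    have t: "t = \<delta> + (fr v + v)"
      by (simp add: \<delta>_def add_ac)
    have "?T \<delta> = of_nat j * \<delta>"
      using \<delta> by (auto simp: finite_field_trace_def power_0_left)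
    then have Tt: "?T t = of_nat j * \<delta> + \<epsilon>"
      using fr_T[OF cv \<epsilon>] unfolding t trace_add trace_fr by simp
    show "\<exists>w. cj w = w + 1 \<and> fr w + w = t"
    proof (cases "\<delta> = 0")
      case True
      then show ?thesis
        using T Tt \<epsilon> cv t by auto
    next
      case False
      with \<delta> have \<delta>1: "\<delta> = 1"
        by simp
      \<comment> \<open>The error \<open>\<delta> = 1\<close> is repaired by adding
        \<open>\<omega>\<close>, which \<open>fr\<close> shifts by one and \<open>cj\<close> shifts
        by \<open>of_nat j\<close>. The nonzero trace \<open>of_nat j + \<epsilon>\<close> is then
        exactly the shift of \<open>v + \<omega>\<close> under \<open>cj\<close>.\<close>
      obtain w0 where w0: "cj w0 = w0 + 1"
        by (rule half_trace_element)
      define \<omega> where "\<omega> = ?T w0"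
      have "\<omega> ^ (2 ^ m) = \<omega> + 1"
        using trace_frobenius[OF km, of w0] w0 by (simp add: \<omega>_def add_ac)
      from frobenius_shift_iterate[OF this, of j] have "\<omega> ^ (2 ^ (m * j)) = \<omega> + of_nat j"
        by simp
      then have c\<omega>: "cj \<omega> = \<omega> + of_nat j"
        by (metis cj_def km)
      have f\<omega>: "fr \<omega> + \<omega> = 1"
        unfolding \<omega>_def using w0 by (intro fr_T) auto
      have "of_nat j + \<epsilon> = 1"
        using T \<epsilon> unfolding Tt \<delta>1 by (auto simp: of_nat_parity split: if_splits)
      then have "cj (v + \<omega>) = v + \<omega> + 1"
        by (simp add: cv c\<omega> add_ac)
      moreover have "fr (v + \<omega>) + (v + \<omega>) = (fr \<omega> + \<omega>) + (fr v + v)"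
        by (simp add: add_ac)
      ultimately show ?thesis
        using t \<delta>1 f\<omega> by metis
    qed
  qed
qed

end

subsection \<open>The associated rational function on the roots of unity\<close>

locale binary_quadrinomial = binary_tower k l fld
  for k l :: nat and fld :: "'a::finite_field itself" +
  fixes a b d :: 'a
begin

section \<open>The rational function and its coincidence equation\<close>

definition num :: "'a \<Rightarrow> 'a" where
  "num y = cj d * fr y * y + fr y + cj b * y + cj a"
text \<open>For \<open>s\<close> in \<open>mu\<close>, \<open>cj s * den s\<close> is the value of
  \<open>1 + b * X + a * X ^ v + d * X ^ u\<close> at \<open>X = s ^ (2 ^ l - 1)\<close> when
  \<open>u\<close> and \<open>v\<close> satisfy the congruences of the theorem. On
  \<open>mu\<close>, \<open>num\<close> is its conjugate reciprocal.\<close>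

definition den :: "'a \<Rightarrow> 'a" where
  "den y = a * fr y * y + b * fr y + y + d"
text \<open>Injectivity of \<open>num / den\<close> on \<open>mu\<close>, cross-multiplied. This
  form also excludes zeros of \<open>den\<close> on \<open>mu\<close>, since these are zeros of
  \<open>num\<close> as well.\<close>

definition separating :: bool where
  "separating \<longleftrightarrow> (\<forall>x\<in>mu. \<forall>y\<in>mu. x \<noteq> y \<longrightarrow> num x * den y \<noteq> num y * den x)"

text \<open>Condition (1) concerns \<open>e\<close>, condition (2) relates \<open>fr h\<close> to
  \<open>g\<close>, and condition (3) takes the trace of \<open>n / e\<close>.\<close>

definition e :: 'a where "e = 1 + a * cj a + b * cj b + d * cj d"
definition n :: 'a where "n = a * cj a + d * cj d"
definition g :: 'a where "g = a + b * cj d"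
definition h :: 'a where "h = cj d + a * cj b"

definition pA :: "'a \<Rightarrow> 'a" where "pA z = g * z ^ 2 + e * z + cj g"
definition pB :: "'a \<Rightarrow> 'a" where "pB z = h * z ^ 2 + e * z + cj h"
definition collision :: "'a \<Rightarrow> 'a \<Rightarrow> 'a" where
  "collision y s = (g * fr y + h * y + n) * y * fr y + pB y * s * fr y + pA (fr y) * fr s * y"

lemma cj_e [simp]: "cj e = e" and cj_n [simp]: "cj n = n"
  by (simp_all add: e_def n_def algebra_simps)

lemma n_e_identity: "n ^ 2 + n * e = g * cj g + h * cj h"
  by (simp add: n_def e_def g_def h_def algebra_simps power2_eq_square)

lemma num_mu: "y \<in> mu \<Longrightarrow> num y = y * fr y * cj (den y)"
proof -
  assume "y \<in> mu"
  then have "y * cj y = 1" "fr y * cj (fr y) = 1"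
    by (simp_all add: mu_def flip: fr_cj fr_mult)
  moreover have "y * fr y * cj (den y) = cj a * (fr y * cj (fr y)) * (y * cj y)
      + cj b * y * (fr y * cj (fr y)) + (y * cj y) * fr y + cj d * fr y * y"
    by (simp add: den_def algebra_simps)
  ultimately show ?thesis
    by (simp add: num_def algebra_simps)
qed

text \<open>Since \<open>num\<close> and \<open>den\<close> are of degree at most one in each of
  \<open>x\<close> and \<open>fr x\<close>, the factors \<open>s\<close> and \<open>fr s\<close>
  clear the denominators of \<open>x = y * (s + 1) / s\<close>. The term in \<open>s * fr s\<close>
  has coefficient twice \<open>num y * den y\<close> and disappears.\<close>

lemma collision_identity:
  assumes "x * s = y * s + y"
  shows "(num x * den y + num y * den x) * fr s * s = collision y s"
proof -
  have fx: "fr x * fr s = fr y * fr s + fr y"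
    using assms by (metis fr_add fr_mult)
  have nx: "num x * (fr s * s) = cj d * (fr x * fr s) * (x * s) + (fr x * fr s) * s
      + cj b * (x * s) * fr s + cj a * fr s * s"
    by (simp add: num_def algebra_simps)
  have dx: "den x * (fr s * s) = a * (fr x * fr s) * (x * s) + b * (fr x * fr s) * s
      + (x * s) * fr s + d * fr s * s"
    by (simp add: den_def algebra_simps)
  have "(num x * den y + num y * den x) * fr s * s
      = num x * (fr s * s) * den y + num y * (den x * (fr s * s))"
    by (simp add: algebra_simps)
  also have "\<dots> = collision y s"
    unfolding nx dx fx assms
    by (simp add: num_def den_def collision_def pA_def pB_def e_def n_def g_def h_def
        algebra_simps power2_eq_square)
  finally show ?thesis .
qed

text \<open>For fixed \<open>y\<close> in \<open>mu\<close>, \<open>s = y / (x + y)\<close> matches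
  the points \<open>x\<close> of \<open>mu\<close> other than \<open>y\<close> with the solutions of
  \<open>cj s = s + 1\<close>, as \<open>(s + 1) / s\<close> has norm one precisely for
  these.\<close>

lemma separating_iff_collision:
  "separating \<longleftrightarrow> (\<forall>y\<in>mu. \<forall>s. cj s = s + 1 \<longrightarrow> collision y s \<noteq> 0)"
proof
  assume sep: separating
  show "\<forall>y\<in>mu. \<forall>s. cj s = s + 1 \<longrightarrow> collision y s \<noteq> 0"
  proof (intro ballI allI impI)
    fix y s
    assume y: "y \<in> mu" and s: "cj s = s + 1"
    have "s \<noteq> 0"
      using s by auto
    then have s1: "s + 1 \<noteq> 0"
      using s by (metis cj_eq_0_iff)
    have "cj ((s + 1) / s) = s / (s + 1)"
      using s by (simp add: add.assoc)
    then have "(s + 1) / s \<in> mu"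
      using s1 \<open>s \<noteq> 0\<close> by (simp add: mu_def)
    then have x: "y * ((s + 1) / s) \<in> mu"
      using y by (intro mu_mult)
    have "(s + 1) / s \<noteq> 1"
      using \<open>s \<noteq> 0\<close> by simp
    then have "y * ((s + 1) / s) \<noteq> y"
      using mu_nonzero[OF y] by (metis mult_cancel_left mult.right_neutral)
    then have "num (y * ((s + 1) / s)) * den y \<noteq> num y * den (y * ((s + 1) / s))"
      using sep x y unfolding separating_def by blast
    moreover have "y * ((s + 1) / s) * s = y * s + y"
    proof -
      have "y * ((s + 1) / s) * s = y * (s + 1)"
        using \<open>s \<noteq> 0\<close> by simp
      then show ?thesis
        by (simp add: distrib_left)
    qed
    ultimately show "collision y s \<noteq> 0"
      using collision_identity[of "y * ((s + 1) / s)" s y] \<open>s \<noteq> 0\<close>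
      by (metis add_eq_0_iff_eq fr_eq_0_iff mult_eq_0_iff)
  qed
next
  assume col: "\<forall>y\<in>mu. \<forall>s. cj s = s + 1 \<longrightarrow> collision y s \<noteq> 0"
  show separating
    unfolding separating_def
  proof (intro ballI impI)
    fix x y
    assume xy: "x \<in> mu" "y \<in> mu" "x \<noteq> y"
    have nz: "x + y \<noteq> 0" "x \<noteq> 0" "y \<noteq> 0"
      using xy by (auto simp: add_eq_0_iff_eq mu_nonzero)
    have "cj (x + y) = (x + y) / (x * y)"
      using nz xy by (simp add: mu_cj field_simps)
    then have "cj (y / (x + y)) = x / (x + y)"
      using nz xy by (simp add: mu_cj)
    also have "\<dots> = y / (x + y) + 1"
      using nz by (simp add: field_simps)
    finally have "collision y (y / (x + y)) \<noteq> 0"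
      using col xy by blast
    moreover have "x * (y / (x + y)) = y * (y / (x + y)) + y"
      using nz by (simp add: field_simps)
    ultimately show "num x * den y \<noteq> num y * den x"
      using collision_identity[of x "y / (x + y)" y] by auto
  qed
qed

section \<open>Necessity of conditions (1) and (2)\<close>

lemma den_mu_nonzero:
  assumes separating "y \<in> mu"
  shows "den y \<noteq> 0"
proof
  assume "den y = 0"
  moreover from this have "num y = 0"
    using num_mu[OF assms(2)] by simp
  moreover obtain x where "x \<in> mu" "x \<noteq> y"
    by (rule mu_other)
  ultimately show False
    using assms unfolding separating_def by fastforce
qed

text \<open>With \<open>pB y = 0\<close> the equation \<open>collision y s = 0\<close> involves
  \<open>s\<close> only through \<open>fr s\<close>, so it can be solved if \<open>pA (fr y)\<close>
  is nonzero. The solution satisfies \<open>cj s = s + 1\<close> because \<open>pB y = 0\<close>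
  also yields \<open>(c + cj c) * z = pA z\<close>.\<close>

lemma common_root_mu:
  assumes separating "y \<in> mu" "pB y = 0"
  shows "pA (fr y) = 0"
proof (rule ccontr)
  assume A: "pA (fr y) \<noteq> 0"
  define z where "z = fr y"
  define c where "c = g * z + h * y + n"
  have y: "y \<noteq> 0" "cj y = 1 / y" "z \<noteq> 0" "cj z = 1 / z"
    using assms(2) by (simp_all add: z_def mu_nonzero mu_cj flip: fr_cj)
  have A': "pA z \<noteq> 0"
    using A by (simp add: z_def)
  obtain s where s: "fr s = c * z / pA z"
    by (rule fr_surj)
  have cA: "cj (pA z) = pA z / z ^ 2"
  proof -
    have "cj (pA z) = cj g * (1 / z) ^ 2 + e * (1 / z) + g"
      by (simp add: pA_def y(4))
    with y(3) show ?thesis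
      by (simp add: pA_def field_simps power2_eq_square)
  qed
  have "cj c = cj g * (1 / z) + cj h * (1 / y) + n"
    by (simp add: c_def y(2,4))
  with y(1,3) have "(c + cj c) * z = g * z ^ 2 + cj g + z * ((h * y ^ 2 + cj h) / y)"
    by (simp add: c_def field_simps power2_eq_square)
  also have "h * y ^ 2 + cj h = e * y"
  proof -
    have "(h * y ^ 2 + cj h) + e * y = 0"
      using assms(3) by (simp add: pB_def add_ac)
    then show ?thesis
      by (simp only: add_eq_0_iff_eq)
  qed
  finally have c: "(c + cj c) * z = pA z"
    using y by (simp add: pA_def algebra_simps)
  have "fr (cj s) = cj c * z / pA z"
    using y A' by (simp add: s cA power2_eq_square)
  also have "\<dots> = (c * z + pA z) / pA z"
    unfolding c[symmetric] by (simp add: algebra_simps)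
  also have "\<dots> = fr (s + 1)"
    using A' by (simp add: s add_divide_distrib)
  finally have "cj s = s + 1"
    by (simp only: fr_eq_iff)
  moreover have "collision y s = 0"
    using A' assms(3) by (simp add: collision_def s c_def flip: z_def)
  ultimately show False
    using assms separating_iff_collision by blast
qed

text \<open>For \<open>e = 0\<close> the quadratic \<open>pB\<close> has no linear term, and the
  square root of \<open>cj h / h\<close> is a root in \<open>mu\<close> (any point serves if
  \<open>h = 0\<close>). There \<open>pA (fr y)\<close> vanishes too, and
  \<open>n_e_identity\<close> kills the remaining coefficient, so \<open>collision y\<close> is
  identically zero.\<close>

lemma e_nonzero:
  assumes separating
  shows "e \<noteq> 0"
proof
  assume e: "e = 0"
  obtain y where y: "y \<in> mu" "pB y = 0"
  proof (cases "h = 0")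
    case True
    then show ?thesis
      using that[of 1] e by (simp add: pB_def)
  next
    case False
    obtain y where y: "y ^ 2 = cj h / h"
      by (rule square_surj)
    have "(y * cj y + 1) ^ 2 = 0"
      using y False by (simp add: square_add power_mult_distrib flip: cj_power)
    then have "y * cj y + 1 = 0"
      by simp
    then have "y \<in> mu"
      by (simp add: mu_def add_eq_0_iff_eq)
    moreover have "pB y = 0"
      using y False e by (simp add: pB_def)
    ultimately show ?thesis
      by (rule that)
  qed
  have A: "pA (fr y) = 0"
    using assms y by (rule common_root_mu)
  have "(g * fr y + h * y + n) ^ 2 = g * (g * fr y ^ 2) + h * (h * y ^ 2) + n ^ 2"
    by (simp only: square_add power_mult_distrib) (simp add: power2_eq_square mult_ac)
  also have "g * fr y ^ 2 = cj g"
    using A e by (simp add: pA_def add_eq_0_iff_eq)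
  also have "h * y ^ 2 = cj h"
    using y e by (simp add: pB_def add_eq_0_iff_eq)
  also have "g * cj g + h * cj h + n ^ 2 = 0"
    using n_e_identity e by (simp add: add_eq_0_iff_eq)
  finally have "g * fr y + h * y + n = 0"
    by simp
  then have "collision y s = 0" for s
    using A y by (simp add: collision_def)
  with assms y(1) half_trace_element separating_iff_collision show False
    by metis
qed

text \<open>
  Here \<open>(x1, x2)\<close> is chosen so that the two linear coefficients of \<open>x1 * num + x2 * den\<close>, regarded as
  a polynomial in \<open>fr y\<close>, share the root \<open>r\<close>; the substitutions \<open>\<psi>\<close> and \<open>\<phi>\<close> then bring the map
  into the shape treated in \<open>twisted_permutation_sum\<close>.
\<close>
lemma common_root_not_mu:
  assumes sep: separating and rho: "r * cj r \<noteq> 1" "pB r = 0"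
  shows "pA (fr r) = 0"
proof -
  \<comment> \<open>\<open>pB r\<close> is the determinant of the linear system for
    \<open>x1\<close> and \<open>x2\<close> stating that both coefficients in \<open>fr y\<close>
    vanish at \<open>y = r\<close>.\<close>
  have det: "(cj d * r + 1) * (r + d) + (a * r + b) * (cj b * r + cj a) = 0"
    using rho(2) by (simp add: pB_def h_def e_def algebra_simps power2_eq_square)
  obtain x1 x2 where x: "x1 \<noteq> 0 \<or> x2 \<noteq> 0"
    and eq: "(cj d * r + 1) * x1 + (a * r + b) * x2 = 0" "(cj b * r + cj a) * x1 + (r + d) * x2 = 0"
    using det by (rule singular_kernel)
  define u v where "u = x1 * cj d + x2 * a" and "v = x1 * cj b + x2"
  have ur: "u * r = x1 + x2 * b" and vr: "v * r = x1 * cj a + x2 * d"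
  proof -
    have "u * r + (x1 + x2 * b) = (cj d * r + 1) * x1 + (a * r + b) * x2"
      "v * r + (x1 * cj a + x2 * d) = (cj b * r + cj a) * x1 + (r + d) * x2"
      by (simp_all add: u_def v_def algebra_simps)
    then show "u * r = x1 + x2 * b" "v * r = x1 * cj a + x2 * d"
      unfolding eq by (simp_all only: add_eq_0_iff_eq)
  qed
  have lin1: "x1 * num y + x2 * den y = (y + r) * (u * fr y + v)" for y
  proof -
    have "x1 * num y + x2 * den y = fr y * (u * y + (x1 + x2 * b)) + (v * y + (x1 * cj a + x2 * d))"
      by (simp add: num_def den_def u_def v_def algebra_simps)
    also have "\<dots> = (y + r) * (u * fr y + v)"
      unfolding ur[symmetric] vr[symmetric] by (simp add: algebra_simps)
    finally show ?thesis .
  qed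
  have cur: "cj u * cj r = cj x1 + cj x2 * cj b" and cvr: "cj v * cj r = cj x1 * a + cj x2 * cj d"
    using arg_cong[OF ur, of cj] arg_cong[OF vr, of cj] by simp_all
  \<comment> \<open>Conjugate counterpart of \<open>lin1\<close>: the factor \<open>y + r\<close>
    becomes its conjugate reciprocal \<open>cj r * y + 1\<close>, and \<open>u\<close> and
    \<open>v\<close> give way to \<open>cj v\<close> and \<open>cj u\<close>.\<close>
  have lin2: "cj x2 * num y + cj x1 * den y = (cj r * y + 1) * (cj u + cj v * fr y)" for y
  proof -
    have "cj x2 * num y + cj x1 * den y = fr y * (y * (cj x1 * a + cj x2 * cj d) + cj v)
        + (y * (cj x1 + cj x2 * cj b) + cj u)"
      by (simp add: num_def den_def u_def v_def algebra_simps)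
    also have "\<dots> = (cj r * y + 1) * (cj u + cj v * fr y)"
      unfolding cur[symmetric] cvr[symmetric] by (simp add: algebra_simps)
    finally show ?thesis .
  qed
  \<comment> \<open>With equal norms, conjugating the relations for \<open>u\<close> and
    \<open>v\<close> gives \<open>u = u * (r * cj r)\<close>, so \<open>u\<close> and
    \<open>v\<close> vanish. Then \<open>num\<close> and \<open>den\<close> are proportional,
    contradicting \<open>separating\<close>.\<close>
  have norm: "x1 * cj x1 \<noteq> x2 * cj x2"
  proof
    assume t: "x1 * cj x1 = x2 * cj x2"
    define t where "t = x1 * cj x1"
    have x12: "x1 \<noteq> 0" "x2 \<noteq> 0" "t \<noteq> 0" "cj t = t"
      using x t by (auto simp: t_def mult.commute)
    have "cj v * (x1 * x2) = (x1 * cj x1) * (x2 * b) + x1 * (x2 * cj x2)"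
      by (simp add: v_def algebra_simps)
    also have "\<dots> = t * (u * r)"
      unfolding ur t[symmetric] t_def[symmetric] by (simp add: algebra_simps t_def)
    finally have v1: "cj v * (x1 * x2) = t * (u * r)" .
    have "cj u * (x1 * x2) = (x1 * cj x1) * (x2 * d) + x1 * (x2 * cj x2) * cj a"
      by (simp add: u_def algebra_simps)
    also have "\<dots> = t * (v * r)"
      unfolding vr t[symmetric] t_def[symmetric] by (simp add: algebra_simps t_def)
    finally have u1: "cj u * (x1 * x2) = t * (v * r)" .
    from arg_cong[OF u1, of cj] have "u * (cj x1 * cj x2) = t * (cj v * cj r)"
      using x12 by simp
    then have "u * (cj x1 * cj x2) * (x1 * x2) = t * cj r * (cj v * (x1 * x2))"
      by simp
    also have "\<dots> = t * t * u * (r * cj r)"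
      unfolding v1 by (simp add: mult_ac)
    also have "u * (cj x1 * cj x2) * (x1 * x2) = u * (x1 * cj x1) * (x2 * cj x2)"
      by (simp add: mult_ac)
    also have "\<dots> = t * t * u"
      unfolding t[symmetric] t_def[symmetric] by (simp add: mult_ac)
    finally have "u = 0"
      using rho(1) x12 by auto
    then have "v = 0"
      using v1 x12 by simp
    have lin0: "x1 * num y = x2 * den y" for y
      using lin1[of y] \<open>u = 0\<close> \<open>v = 0\<close> by (simp add: add_eq_0_iff_eq)
    obtain y where y: "y \<in> mu" "y \<noteq> 1"
      by (rule mu_other)
    have "x1 * (num y * den 1) = x1 * (num 1 * den y)"
      using lin0[of y] lin0[of 1] by (metis mult.assoc mult.commute)
    then show False
      using x12 sep y unfolding separating_def by auto
  qed
  \<comment> \<open>The factors \<open>1\<close> and \<open>cj 1\<close> match the shape of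
    \<open>moebius_mu\<close> with \<open>s = 1\<close> and \<open>t = r\<close>.\<close>
  define \<psi> where "\<psi> y = (1 * y + r) / (cj r * y + cj 1)" for y
  define \<phi> where "\<phi> y = (x1 * y + x2) / (cj x2 * y + cj x1)" for y
  define G where "G y = num y / den y" for y
  have rn: "1 * cj 1 \<noteq> r * cj r"
    using rho(1) by simp
  have \<psi>: "\<psi> y \<in> mu" "cj r * y + 1 \<noteq> 0" if "y \<in> mu" for y
    using moebius_mu[OF rn that] by (simp_all add: \<psi>_def)
  have G: "G y \<in> mu" if "y \<in> mu" for y
  proof -
    have "den y \<noteq> 0"
      using den_mu_nonzero[OF sep that] .
    moreover have "y * cj y = 1" "fr y * cj (fr y) = 1"
      using that by (simp_all add: mu_def flip: fr_cj fr_mult)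
    ultimately show ?thesis
      by (simp add: G_def num_mu[OF that] mu_def) (simp add: algebra_simps)
  qed
  have \<phi>: "\<phi> y \<in> mu" if "y \<in> mu" for y
    using moebius_mu[OF norm that] by (simp add: \<phi>_def)
  have inj\<psi>: "inj_on \<psi> mu"
    unfolding \<psi>_def by (rule moebius_inj[OF rn])
  have injG: "inj_on G mu"
    by (rule inj_onI, rule ccontr)
      (use sep den_mu_nonzero[OF sep] in \<open>auto simp: G_def frac_eq_eq separating_def\<close>)
  have inj\<phi>: "inj_on \<phi> mu"
    unfolding \<phi>_def by (rule moebius_inj[OF norm])
  have "inj_on (\<lambda>y. \<phi> (G (\<psi> y))) mu"
    by (rule inj_onI) (meson inj_onD[OF inj\<psi>] inj_onD[OF injG] inj_onD[OF inj\<phi>] \<psi>(1) G)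
  moreover have "(\<lambda>y. \<phi> (G (\<psi> y))) ` mu \<subseteq> mu"
    using \<psi> G \<phi> by auto
  ultimately have bij: "bij_betw (\<lambda>y. \<phi> (G (\<psi> y))) mu mu"
    by (metis bij_betw_def endo_inj_surj finite)
  define \<tau> \<sigma> where "\<tau> = u + v * fr (cj r)" and "\<sigma> = u * fr r + v"
  have comp: "\<phi> (G (\<psi> y)) = y * (\<tau> * fr y + \<sigma>) / (cj \<tau> + cj \<sigma> * fr y)"
    and comp_nz: "cj \<tau> + cj \<sigma> * fr y \<noteq> 0" if y: "y \<in> mu" for y
  proof -
    define x where "x = \<psi> y"
    have x: "x \<in> mu" and w: "cj r * y + 1 \<noteq> 0"
      using \<psi>[OF y] by (simp_all add: x_def)
    define w where "w = cj r * y + 1"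
    have "w \<noteq> 0"
      using w by (simp add: w_def)
    then have "fr w \<noteq> 0"
      by (metis fr_eq_0_iff)
    have xw: "x = (y + r) / w"
      by (simp add: x_def \<psi>_def w_def)
    have D: "den x \<noteq> 0"
      using den_mu_nonzero[OF sep x] .
    have "\<phi> (G x) = (x1 * num x + x2 * den x) / (cj x2 * num x + cj x1 * den x)"
    proof -
      have "x1 * G x + x2 = (x1 * num x + x2 * den x) / den x"
        "cj x2 * G x + cj x1 = (cj x2 * num x + cj x1 * den x) / den x"
        using D by (simp_all add: G_def field_simps)
      then show ?thesis
        using D by (simp add: \<phi>_def)
    qed
    then have *: "\<phi> (G x) = (x + r) * (u * fr x + v) / ((cj r * x + 1) * (cj u + cj v * fr x))"
      unfolding lin1 lin2 .
    have "x + r = y * (1 + r * cj r) / w"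
      using \<open>w \<noteq> 0\<close> unfolding xw by (simp add: divide_add_eq_iff) (simp add: w_def algebra_simps)
    moreover have "cj r * x + 1 = (1 + r * cj r) / w"
      using \<open>w \<noteq> 0\<close> unfolding xw by (simp add: divide_add_eq_iff) (simp add: w_def algebra_simps)
    moreover have "u * fr x + v = (\<tau> * fr y + \<sigma>) / fr w"
      using \<open>fr w \<noteq> 0\<close> unfolding xw fr_divide
      by (simp add: divide_add_eq_iff) (simp add: w_def \<tau>_def \<sigma>_def algebra_simps)
    moreover have cuv: "cj u + cj v * fr x = (cj \<tau> + cj \<sigma> * fr y) / fr w"
      using \<open>fr w \<noteq> 0\<close> unfolding xw fr_divide
      by (simp add: add_divide_eq_iff) (simp add: w_def \<tau>_def \<sigma>_def algebra_simps)
    moreover have "1 + r * cj r \<noteq> 0"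
      using rho(1) by (metis add_eq_0_iff_eq)
    ultimately show "\<phi> (G (\<psi> y)) = y * (\<tau> * fr y + \<sigma>) / (cj \<tau> + cj \<sigma> * fr y)"
      using * \<open>w \<noteq> 0\<close> \<open>fr w \<noteq> 0\<close> by (simp flip: x_def)
    have "cj x2 * G x + cj x1 \<noteq> 0"
      using moebius_mu(1)[OF norm G[OF x]] .
    then have "cj x2 * num x + cj x1 * den x \<noteq> 0"
      using D by (simp add: G_def field_simps)
    then show "cj \<tau> + cj \<sigma> * fr y \<noteq> 0"
      unfolding lin2 cuv by auto
  qed
  have "(\<Sum>y\<in>mu. y * (\<tau> * fr y + \<sigma>) / (cj \<tau> + cj \<sigma> * fr y)) = (\<Sum>y\<in>mu. \<phi> (G (\<psi> y)))"
    by (simp add: comp)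
  also have "\<dots> = (\<Sum>y\<in>mu. y ^ 1)"
    using sum.reindex_bij_betw[OF bij, of "\<lambda>y. y"] by simp
  also have "\<dots> = 0"
    using k_pos by (intro mu_power_sum_eq_0) simp_all
  finally have sum0: "(\<Sum>y\<in>mu. y * (\<tau> * fr y + \<sigma>) / (cj \<tau> + cj \<sigma> * fr y)) = 0" .
  have "z \<in> mu \<Longrightarrow> cj \<tau> + cj \<sigma> * z \<noteq> 0" for z
  proof -
    assume z: "z \<in> mu"
    obtain y where y: "fr y = z"
      by (rule fr_surj)
    have "fr (y * cj y) = fr 1"
      using z y by (simp add: mu_def)
    then have "y \<in> mu"
      by (simp only: fr_eq_iff mu_def mem_Collect_eq)
    from comp_nz[OF this] show ?thesis
      by (simp add: y)
  qed
  from twisted_permutation_sum[OF this sum0] have "\<tau> = 0 \<or> \<sigma> = 0" .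
  \<comment> \<open>Now \<open>x1 * num + x2 * den\<close> is read as a polynomial in
    \<open>y\<close>: if \<open>u * p + v * q = 0\<close>, both of its coefficients vanish at the
    point \<open>p : q\<close> of the variable \<open>fr y\<close>. The determinant \<open>M\<close>
    of that system is the homogenized \<open>pA\<close>.\<close>
  moreover have "g * p ^ 2 + e * p * q + cj g * q ^ 2 = 0" if pq: "u * p + v * q = 0" for p q
  proof -
    have 1: "x1 * (cj d * p + cj b * q) + x2 * (a * p + q) = 0"
      using pq by (simp add: u_def v_def algebra_simps)
    have "x1 * (p + cj a * q) + x2 * (b * p + d * q) = (u * r) * p + (v * r) * q"
      unfolding ur vr by (simp add: algebra_simps)
    also have "\<dots> = (u * p + v * q) * r"
      by (simp add: algebra_simps)
    finally have 2: "x1 * (p + cj a * q) + x2 * (b * p + d * q) = 0"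
      using pq by simp
    define M where "M = (cj d * p + cj b * q) * (b * p + d * q) + (a * p + q) * (p + cj a * q)"
    have "x1 * M = (x1 * (cj d * p + cj b * q) + x2 * (a * p + q)) * (b * p + d * q)
        + (x1 * (p + cj a * q) + x2 * (b * p + d * q)) * (a * p + q)"
      by (simp add: M_def algebra_simps)
    moreover have "x2 * M = (x1 * (cj d * p + cj b * q) + x2 * (a * p + q)) * (p + cj a * q)
        + (x1 * (p + cj a * q) + x2 * (b * p + d * q)) * (cj d * p + cj b * q)"
      by (simp add: M_def algebra_simps)
    ultimately have "M = 0"
      using 1 2 x by auto
    moreover have "M = g * p ^ 2 + e * p * q + cj g * q ^ 2"
      by (simp add: M_def g_def e_def algebra_simps power2_eq_square)
    ultimately show ?thesis
      by simp
  qed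
  note form = this
  ultimately consider "g * 1 ^ 2 + e * 1 * fr (cj r) + cj g * fr (cj r) ^ 2 = 0" | "\<sigma> = 0"
    using form[of 1 "fr (cj r)"] by (auto simp: \<tau>_def)
  then show ?thesis
  proof cases
    case 1
    from arg_cong[OF this, of cj] show ?thesis
      by (simp add: pA_def add_ac)
  next
    case 2
    then show ?thesis
      using form[of "fr r" 1] by (simp add: \<sigma>_def pA_def)
  qed
qed

lemma common_root:
  assumes separating "pB r = 0"
  shows "pA (fr r) = 0"
  using assms common_root_mu common_root_not_mu by (cases "r \<in> mu") (auto simp: mu_def)

text \<open>Scaling by \<open>e / h\<close> turns \<open>pB\<close> into an Artin-Schreier equation
  with right-hand side fixed by \<open>cj\<close>, so both roots of \<open>pB\<close> lie in the
  field and differ by \<open>e / h\<close>. Their images under \<open>fr\<close> are roots of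
  \<open>pA\<close>, and comparing the two gives \<open>g * fr (e / h) = e\<close>.\<close>

lemma separating_imp_h_g:
  assumes separating
  shows "fr h = e ^ (2 ^ l - 1) * g"
proof (cases "h = 0")
  case True
  then have "pB 0 = 0"
    by (simp add: pB_def)
  from common_root[OF assms this] have "g = 0"
    by (simp add: pA_def)
  with True show ?thesis
    by simp
next
  case False
  have e: "e \<noteq> 0"
    using assms by (rule e_nonzero)
  obtain v where v: "v ^ 2 + v = h * cj h / e ^ 2"
    by (rule artin_schreier_root[of "h * cj h / e ^ 2"]) (simp add: mult.commute)
  have root: "pB (e / h * w) = 0" if "w ^ 2 + w = h * cj h / e ^ 2" for w
  proof -
    have "pB (e / h * w) = e ^ 2 / h * (w ^ 2 + w) + cj h"
      using False by (simp add: pB_def field_simps power2_eq_square)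
    also have "\<dots> = 0"
      unfolding that using False e by simp
    finally show ?thesis .
  qed
  have "(v + 1) ^ 2 + (v + 1) = h * cj h / e ^ 2"
    using v by (simp add: square_add algebra_simps)
  then have r: "pB (e / h * v) = 0" "pB (e / h * v + e / h) = 0"
    using root[OF v] root[of "v + 1"] by (simp_all add: distrib_left)
  define z w where "z = fr (e / h * v)" and "w = fr (e / h)"
  have "pA z = 0" "pA (z + w) = 0"
    using common_root[OF assms r(1)] common_root[OF assms r(2)] by (simp_all only: z_def w_def fr_add)
  moreover have "pA (z + w) + pA z = w * (g * w + e)"
    by (simp add: pA_def square_add) (simp add: algebra_simps power2_eq_square)
  moreover have "w \<noteq> 0"
    using e False unfolding w_def fr_eq_0_iff by simp
  ultimately have "g * w = e"
    by (simp add: add_eq_0_iff_eq)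
  then have "g * fr e = e * fr h"
    using False by (simp add: w_def field_simps)
  moreover have "fr e = e * e ^ (2 ^ l - 1)"
    using power_minus_mult[of "2 ^ l" e] by (simp add: fr_def mult.commute)
  ultimately show ?thesis
    using e by (simp add: mult_ac)
qed

section \<open>The coincidence equation under conditions (1) and (2)\<close>

lemma cj_fr_e [simp]: "cj (fr e) = fr e"
  by (metis fr_cj cj_e)

text \<open>A nonzero quadratic cannot vanish at three distinct points \<open>1\<close>,
  \<open>y\<close> and \<open>1 / y\<close> of \<open>mu\<close>.\<close>

lemma pB_not_identically_0:
  assumes "e \<noteq> 0"
  obtains y where "y \<in> mu" "pB y \<noteq> 0"
proof -
  have "\<exists>y\<in>mu. pB y \<noteq> 0"
  proof (rule ccontr)
    assume "\<not> ?thesis"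
    then have root: "pB y = 0" if "y \<in> mu" for y
      using that by blast
    have shift: "h * (y + 1) = e" if "y \<in> mu" "y \<noteq> 1" for y
    proof -
      have "(y + 1) * (h * (y + 1) + e) = pB y + pB 1"
        by (simp add: pB_def algebra_simps power2_eq_square)
      also have "\<dots> = 0"
        using root that by simp
      finally show ?thesis
        using that by (simp add: add_eq_0_iff_eq)
    qed
    obtain y where y: "y \<in> mu" "y \<noteq> 1"
      by (rule mu_other)
    have y0: "y \<noteq> 0"
      using y by (simp add: mu_nonzero)
    have "1 / y \<in> mu" "1 / y \<noteq> 1"
      using y y0 mu_divide[of 1 y] by auto
    from shift[OF y] shift[OF this] have "h * (y + 1) = h * (1 / y + 1)" "h \<noteq> 0"
      using assms by auto
    then have "y = 1 / y"
      by simp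
    then have "(y + 1) ^ 2 = 0"
      using y0 by (simp add: square_add field_simps power2_eq_square)
    then show False
      using y by (simp add: add_eq_0_iff_eq)
  qed
  with that show ?thesis
    by blast
qed

text \<open>Condition (2) makes \<open>e * fr (pB y)\<close> equal to
  \<open>fr e * pA (fr y)\<close>, so applying \<open>fr\<close> to the definition of
  \<open>w\<close> reproduces the \<open>fr s\<close> term of \<open>collision\<close>. The
  resulting equation for \<open>w\<close> does not mention \<open>y\<close>, so a single
  \<open>y\<close> with \<open>pB y\<close> nonzero suffices to transfer a solution back.\<close>

lemma separating_iff_no_shift:
  assumes e: "e \<noteq> 0" and hg: "fr h = e ^ (2 ^ l - 1) * g"
  shows "separating \<longleftrightarrow> (\<nexists>w. cj w = w + 1 \<and> fr w + w = n / e)"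
proof -
  have "fr e = e ^ (2 ^ l - 1) * e"
    using power_minus_mult[of "2 ^ l" e] by (simp add: fr_def)
  then have eh: "e * fr h = fr e * g"
    using hg by (simp add: mult_ac)
  then have ech: "e * cj (fr h) = fr e * cj g"
    by (metis cj_mult cj_e cj_fr_e)
  have "e * fr (pB y) = (e * fr h) * fr y ^ 2 + e * fr e * fr y + e * cj (fr h)" for y
    by (simp add: pB_def algebra_simps)
  then have pBA: "e * fr (pB y) = fr e * pA (fr y)" for y
    by (simp add: eh ech pA_def algebra_simps)
  have cpB: "cj (pB y) = pB y / y ^ 2" if "y \<in> mu" for y
  proof -
    have "cj (pB y) = cj h * (1 / y) ^ 2 + e * (1 / y) + h"
      by (simp add: pB_def mu_cj[OF that])
    with mu_nonzero[OF that] show ?thesis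
      by (simp add: pB_def field_simps power2_eq_square)
  qed
  have key: "collision y s = y * fr y * (e * (fr w + w) + n)"
    if "y \<in> mu" "e * w = pB y * s / y + h * y" for y s w
  proof -
    have y: "y \<noteq> 0" "fr y \<noteq> 0"
      using that(1) by (simp_all add: mu_nonzero)
    have fe: "fr e \<noteq> 0"
      using e by simp
    have "fr (e * w) = fr (pB y * s / y + h * y)"
      using that(2) by simp
    then have "fr e * fr w = fr (pB y) * fr s / fr y + fr h * fr y"
      by simp
    then have "e * (fr e * fr w) = (e * fr (pB y)) * fr s / fr y + (e * fr h) * fr y"
      by (simp add: distrib_left mult.assoc)
    then have "fr e * (e * fr w) = (e * fr (pB y)) * fr s / fr y + (e * fr h) * fr y"
      by (simp only: mult.left_commute)
    also have "\<dots> = fr e * (pA (fr y) * fr s / fr y + g * fr y)"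
      unfolding pBA eh by (simp add: algebra_simps)
    finally have fw: "e * fr w = pA (fr y) * fr s / fr y + g * fr y"
      using fe by simp
    have "e * (fr w + w) + n = (pA (fr y) * fr s / fr y + g * fr y) + (pB y * s / y + h * y) + n"
      by (simp only: distrib_left fw that(2))
    also have "y * fr y * \<dots> = collision y s"
      using y by (simp add: collision_def algebra_simps)
    finally show ?thesis ..
  qed
  have shift: "cj w = w + 1 \<longleftrightarrow> cj s = s + 1"
    if "y \<in> mu" "e * w = pB y * s / y + h * y" "pB y \<noteq> 0" for y s w
  proof -
    have y: "y \<noteq> 0"
      using that by (simp add: mu_nonzero)
    have "e * cj w = cj (e * w)"
      by simp
    also have "\<dots> = pB y / y * cj s + cj h / y"
      unfolding that(2) using y
      by (simp add: cpB[OF that(1)] mu_cj[OF that(1)] power2_eq_square)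
    finally have "e * (cj w + w + 1) = pB y / y * cj s + cj h / y + (pB y * s / y + h * y) + e"
      by (simp only: distrib_left that(2) mult_1_right)
    also have "\<dots> = pB y / y * (cj s + s + 1)"
      using y by (simp add: distrib_left) (simp add: pB_def field_simps power2_eq_square)
    finally have "cj w + w + 1 = 0 \<longleftrightarrow> cj s + s + 1 = 0"
      using e y that(3) by (metis divide_eq_0_iff mult_eq_0_iff)
    then show ?thesis
      by (simp only: add.assoc add_eq_0_iff_eq)
  qed
  have shift': "cj w = w + 1"
    if "y \<in> mu" "e * w = pB y * s / y + h * y" "cj s = s + 1" for y s w
  proof (cases "pB y = 0")
    case False
    then show ?thesis
      using shift that by blast
  next
    \<comment> \<open>Here \<open>w = h * y / e\<close> does not depend on \<open>s\<close>, and its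
      shift under \<open>cj\<close> comes from \<open>pB y = 0\<close> itself.\<close>
    case True
    have y: "y \<noteq> 0"
      using that by (simp add: mu_nonzero)
    have "e * w = h * y"
      using that True by simp
    have "e * cj w = cj (e * w)"
      by simp
    also have "\<dots> = cj h / y"
      unfolding \<open>e * w = h * y\<close> by (simp add: mu_cj[OF that(1)])
    finally have "e * cj w = cj h / y" .
    then have "e * (cj w + w + 1) = pB y / y"
      using y \<open>e * w = h * y\<close> unfolding distrib_left
      by (simp add: pB_def field_simps power2_eq_square)
    then have "cj w + (w + 1) = 0"
      using True e by (simp add: add.assoc)
    then show ?thesis
      by (simp only: add_eq_0_iff_eq)
  qed
  have zero: "e * (fr w + w) + n = 0 \<longleftrightarrow> fr w + w = n / e" for w
    unfolding add_eq_0_iff_eq using e by (simp add: eq_divide_eq mult.commute)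
  show ?thesis
  proof
    assume sep: separating
    show "\<nexists>w. cj w = w + 1 \<and> fr w + w = n / e"
    proof
      assume "\<exists>w. cj w = w + 1 \<and> fr w + w = n / e"
      then obtain w where w: "cj w = w + 1" "fr w + w = n / e"
        by auto
      obtain y where y: "y \<in> mu" "pB y \<noteq> 0"
        using e by (rule pB_not_identically_0)
      define s where "s = (e * w + h * y) * y / pB y"
      have s: "e * w = pB y * s / y + h * y"
        using y mu_nonzero[OF y(1)] by (simp add: s_def add.assoc)
      have "cj s = s + 1"
        using shift[OF y(1) s y(2)] w by simp
      moreover have "collision y s = 0"
        using key[OF y(1) s] zero[THEN iffD2, OF w(2)] by (simp only: mult_zero_right)
      ultimately show False
        using sep y separating_iff_collision by blast
    qed
  next
    assume no: "\<nexists>w. cj w = w + 1 \<and> fr w + w = n / e"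
    show separating
      unfolding separating_iff_collision
    proof (intro ballI allI impI)
      fix y s
      assume y: "y \<in> mu" and s: "cj s = s + 1"
      define w where "w = (pB y * s / y + h * y) / e"
      have w: "e * w = pB y * s / y + h * y"
        using e by (simp add: w_def)
      have "fr w + w \<noteq> n / e"
        using shift'[OF y w s] no by blast
      then show "collision y s \<noteq> 0"
        using key[OF y w] y zero by (simp add: mu_nonzero)
    qed
  qed
qed

lemma separating_iff:
  assumes "k = m * j" "l = m * i" "odd i"
  shows "separating \<longleftrightarrow> e \<noteq> 0 \<and> fr h = e ^ (2 ^ l - 1) * g
    \<and> finite_field_trace (2 ^ m) j (n / e) = 0"
proof -
  have "separating \<longleftrightarrow> finite_field_trace (2 ^ m) j (n / e) = 0"
    if e: "e \<noteq> 0" and hg: "fr h = e ^ (2 ^ l - 1) * g"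
  proof -
    \<comment> \<open>Condition (2) gives \<open>g * cj g / e ^ 2 = fr \<theta>\<close>, which turns
      \<open>n_e_identity\<close> into the quadratic relation required by
      \<open>fr_shift_iff_trace\<close>.\<close>
    define \<theta> where "\<theta> = h * cj h / e ^ 2"
    have c\<theta>: "cj \<theta> = \<theta>"
      by (simp add: \<theta>_def mult.commute)
    have "fr e = e ^ (2 ^ l - 1) * e"
      using power_minus_mult[of "2 ^ l" e] by (simp add: fr_def)
    then have hg': "g / e = fr h / fr e"
      using e hg by simp
    then have "cj g / e = cj (fr h) / fr e"
      by (metis cj_divide cj_e cj_fr_e)
    with hg' have "(g / e) * (cj g / e) = fr \<theta>"
      by (simp add: \<theta>_def power2_eq_square)
    then have "g * cj g / e ^ 2 = fr \<theta>"
      by (simp add: power2_eq_square)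
    moreover have "(n / e) ^ 2 + n / e = (n ^ 2 + n * e) / e ^ 2"
      using e by (simp add: power2_eq_square add_divide_distrib)
    ultimately have "(n / e) ^ 2 + n / e = fr \<theta> + \<theta>"
      by (simp add: n_e_identity add_divide_distrib \<theta>_def)
    from fr_shift_iff_trace[OF assms c\<theta> this] separating_iff_no_shift[OF e hg]
    show ?thesis
      by simp
  qed
  then show ?thesis
    using e_nonzero separating_imp_h_g by blast
qed

section \<open>From the polynomial to the rational function\<close>

lemma permutation_iff_separating:
  fixes f :: "'a poly"
  assumes coprime: "coprime (2 ^ l - 1) ((2::nat) ^ k + 1)"
    and u: "[u * (2 ^ l - 1) = 2 ^ k] (mod (2 ^ k + 1))"
    and v: "[v * (2 ^ l - 1) = 2 ^ l] (mod (2 ^ k + 1))"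
    and f: "f = monom 1 1 * pcompose (1 + monom b 1 + monom a v + monom d u) (monom 1 (2 ^ k - 1))"
  shows "permutation_poly f \<longleftrightarrow> separating"
proof -
  \<comment> \<open>\<open>c\<close> inverts the exponent \<open>2 ^ l - 1\<close> on
    \<open>mu\<close>, so every element of \<open>mu\<close> is \<open>s ^ (2 ^ l - 1)\<close> for a
    unique \<open>s\<close> in \<open>mu\<close>.\<close>
  obtain c where c: "[(2 ^ l - 1) * c = (1::nat)] (mod (2 ^ k + 1))"
    using cong_solve_coprime_nat[OF coprime] by auto
  have c_pow: "(s ^ c) ^ (2 ^ l - 1) = s" "(s ^ (2 ^ l - 1)) ^ c = s" if "s \<in> mu" for s
    using mu_power_cong[OF that c] by (simp_all add: mult.commute flip: power_mult)
  have f0: "poly f 0 = 0"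
    by (simp add: f poly_monom)
  have frs: "s ^ (2 ^ l - 1) * s = fr s" for s
    using power_minus_mult[of "2 ^ l" s] by (simp add: fr_def)
  \<comment> \<open>The congruences turn the powers with exponents \<open>v\<close> and
    \<open>u\<close> into \<open>fr s\<close> and \<open>cj s\<close>; inserting
    \<open>s * cj s = 1\<close> then lets \<open>cj s\<close> be factored out.\<close>
  have fx: "poly f x = x * (cj s * den s)" if s: "s \<in> mu" and x: "x ^ (2 ^ k - 1) = s ^ (2 ^ l - 1)" for x s
  proof -
    have 1: "(s ^ (2 ^ l - 1)) ^ v = fr s" "(s ^ (2 ^ l - 1)) ^ u = cj s"
      using mu_power_cong[OF s v] mu_power_cong[OF s u]
      by (simp_all add: fr_def cj_def mult.commute flip: power_mult)
    have "poly f x = x * (1 + b * s ^ (2 ^ l - 1) + a * (s ^ (2 ^ l - 1)) ^ v + d * (s ^ (2 ^ l - 1)) ^ u)"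
      unfolding f by (simp only: poly_mult poly_pcompose poly_add poly_1 poly_monom x mult_1 power_one_right)
    also have "\<dots> = x * (1 + b * s ^ (2 ^ l - 1) + a * fr s + d * cj s)"
      unfolding 1 ..
    also have "1 + b * s ^ (2 ^ l - 1) + a * fr s + d * cj s
        = s * cj s + b * (s ^ (2 ^ l - 1) * (s * cj s)) + a * fr s * (s * cj s) + d * cj s"
      using s by (simp add: mu_def)
    also have "\<dots> = cj s * (s + b * (s ^ (2 ^ l - 1) * s) + a * fr s * s + d)"
      by (simp add: algebra_simps)
    also have "\<dots> = cj s * den s"
      unfolding frs by (simp add: den_def add_ac)
    finally show ?thesis .
  qed
  \<comment> \<open>This ratio fixes \<open>poly f x\<close> up to a factor invariant under
    \<open>cj\<close>, and it depends on \<open>s\<close> alone.\<close>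
  have ratio: "cj (poly f x) / poly f x = num s / den s"
    if s: "s \<in> mu" and x: "x \<noteq> 0" "x ^ (2 ^ k - 1) = s ^ (2 ^ l - 1)" and D: "den s \<noteq> 0" for x s
  proof -
    have s0: "s \<noteq> 0" "cj s = 1 / s"
      using s by (simp_all add: mu_nonzero mu_cj)
    have "cj x / x = fr s / s"
      using x s0(1) frs[of s] power_q_minus_1[OF x(1)] by (metis nonzero_mult_div_cancel_right)
    moreover have "cj (poly f x) / poly f x = (cj x / x) * (s / cj s) * (cj (den s) / den s)"
      by (simp add: fx[OF s x(2)] mult.assoc)
    ultimately show ?thesis
      using s0 by (simp add: num_mu[OF s] s0(2))
  qed
  have preim: "\<exists>x. x \<noteq> 0 \<and> x ^ (2 ^ k - 1) = s ^ (2 ^ l - 1)" if "s \<in> mu" for s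
    by (rule mu_ratioE[OF mu_power[OF that, of "2 ^ l - 1"]]) blast
  have fin: "permutation_poly f \<longleftrightarrow> inj (poly f)"
    unfolding permutation_poly_def bij_def using finite_UNIV_inj_surj[of "poly f"] by auto
  show ?thesis
    unfolding fin
  proof
    assume inj: "inj (poly f)"
    have D: "den s \<noteq> 0" if s: "s \<in> mu" for s
    proof
      assume "den s = 0"
      obtain x where "x \<noteq> 0" "x ^ (2 ^ k - 1) = s ^ (2 ^ l - 1)"
        using preim[OF s] by auto
      with fx[OF s, of x] f0 \<open>den s = 0\<close> inj show False
        by (metis injD mult_zero_right)
    qed
    show separating
      unfolding separating_def
    proof (intro ballI impI notI)
      fix s t
      assume st: "s \<in> mu" "t \<in> mu" "s \<noteq> t" and eq: "num s * den t = num t * den s"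
      obtain x where x: "x \<noteq> 0" "x ^ (2 ^ k - 1) = s ^ (2 ^ l - 1)"
        using preim[OF st(1)] by auto
      obtain y where y: "y \<noteq> 0" "y ^ (2 ^ k - 1) = t ^ (2 ^ l - 1)"
        using preim[OF st(2)] by auto
      define X Y where "X = poly f x" and "Y = poly f y"
      have XY: "X \<noteq> 0" "Y \<noteq> 0"
        using injD[OF inj, of x 0] injD[OF inj, of y 0] f0 x(1) y(1)
        unfolding X_def Y_def by metis+
      have "cj X / X = cj Y / Y"
        using ratio[OF st(1) x D[OF st(1)]] ratio[OF st(2) y D[OF st(2)]] eq D st
        by (simp add: X_def Y_def frac_eq_eq)
      then have q: "cj (X / Y) = X / Y"
        using XY by (simp add: frac_eq_eq mult.commute)
      \<comment> \<open>\<open>f\<close> commutes with scaling by elements fixed by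
        \<open>cj\<close>, so \<open>r * y\<close> has the same image as \<open>x\<close> while
        staying in the fibre of \<open>t\<close>.\<close>
      define r where "r = X / Y"
      have r: "r \<noteq> 0" "cj r = r"
        using XY q by (simp_all add: r_def)
      have "(r * y) ^ (2 ^ k - 1) = t ^ (2 ^ l - 1)"
        using power_q_minus_1[OF r(1)] r y by (simp add: power_mult_distrib)
      from fx[OF st(2) this] fx[OF st(2) y(2)] have "poly f (r * y) = r * Y"
        by (simp add: Y_def)
      also have "\<dots> = poly f x"
        using XY by (simp add: r_def X_def)
      finally have "r * y = x"
        using inj by (simp add: injD)
      with \<open>(r * y) ^ (2 ^ k - 1) = t ^ (2 ^ l - 1)\<close> x have "t ^ (2 ^ l - 1) = s ^ (2 ^ l - 1)"
        by simp
      then show False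
        using c_pow(2)[OF st(1)] c_pow(2)[OF st(2)] st(3) by metis
    qed
  next
    assume sep: separating
    have nz: "poly f x \<noteq> 0" and par: "\<exists>s\<in>mu. x ^ (2 ^ k - 1) = s ^ (2 ^ l - 1)" if "x \<noteq> 0" for x
    proof -
      show par: "\<exists>s\<in>mu. x ^ (2 ^ k - 1) = s ^ (2 ^ l - 1)"
        using ratio_in_mu[OF that] c_pow(1) mu_power by metis
      then obtain s where "s \<in> mu" "x ^ (2 ^ k - 1) = s ^ (2 ^ l - 1)"
        by auto
      then show "poly f x \<noteq> 0"
        using fx that den_mu_nonzero[OF sep] mu_nonzero by simp
    qed
    show "inj (poly f)"
    proof (rule injI)
      fix x y
      assume eq: "poly f x = poly f y"
      show "x = y"
      proof (cases "x = 0 \<or> y = 0")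
        case True
        then show ?thesis
          using eq f0 nz by metis
      next
        case False
        then obtain s t where st: "s \<in> mu" "t \<in> mu"
          and x: "x ^ (2 ^ k - 1) = s ^ (2 ^ l - 1)" and y: "y ^ (2 ^ k - 1) = t ^ (2 ^ l - 1)"
          using par by metis
        have D: "den s \<noteq> 0" "den t \<noteq> 0"
          using den_mu_nonzero[OF sep] st by auto
        have "num s / den s = num t / den t"
          using ratio[OF st(1) _ x D(1)] ratio[OF st(2) _ y D(2)] False eq by simp
        then have "num s * den t = num t * den s"
          using D by (simp add: frac_eq_eq)
        then have "s = t"
          using sep st unfolding separating_def by blast
        then show ?thesis
          using eq fx[OF st(1) x] fx[OF st(2) y] D mu_nonzero[OF st(1)] by simp
      qed
    qed
  qed
qed

end

section \<open>Arithmetic of the exponents \<open>k\<close> and \<open>l\<close>\<close>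

lemma odd_quotient_of_coprime:
  fixes k l :: nat
  assumes "k > 0" "coprime (2 ^ l - 1) ((2::nat) ^ k + 1)"
    and m: "m = 2 ^ multiplicity 2 (gcd k l)"
  shows "m dvd k" "m dvd l" "odd (l div m)"
proof -
  have "m dvd gcd k l"
    unfolding m by (rule multiplicity_dvd)
  then show dvd: "m dvd k" "m dvd l"
    by auto
  show "odd (l div m)"
  proof
    assume "even (l div m)"
    then obtain i where i: "l = 2 * m * i"
      using dvd(2) by (metis dvdE dvd_mult_div_cancel mult.assoc mult.left_commute)
    \<comment> \<open>\<open>m\<close> is the full power of two in \<open>gcd k l\<close>, so the
      two quotients cannot both be even.\<close>
    have "odd (k div m)"
    proof
      assume "even (k div m)"
      then obtain j where "k = 2 * m * j"
        using dvd(1) by (metis dvdE dvd_mult_div_cancel mult.assoc mult.left_commute)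
      with i have "2 * m dvd gcd k l"
        by simp
      then have "2 ^ Suc (multiplicity 2 (gcd k l)) dvd gcd k l"
        by (simp add: m)
      moreover have "\<not> 2 ^ Suc (multiplicity 2 (gcd k l)) dvd gcd k l"
        using assms(1) by (subst power_dvd_iff_le_multiplicity) auto
      ultimately show False
        by contradiction
    qed
    then obtain j where "k div m = 2 * j + 1"
      by (auto elim: oddE)
    then have j: "k = 2 * m * j + m"
      using dvd(1) by (metis add_mult_distrib2 dvd_mult_div_cancel mult.assoc mult.commute mult_1_right)
    \<comment> \<open>Modulo \<open>2 ^ m + 1\<close> the number \<open>2 ^ m\<close> is minus one.
      As \<open>l\<close> is an even and \<open>k\<close> an odd multiple of \<open>m\<close>,
      \<open>p\<close> divides both \<open>2 ^ l - 1\<close> and \<open>2 ^ k + 1\<close>.\<close>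
    define p :: nat where "p = 2 ^ m + 1"
    have sq: "[2 ^ (2 * m) = 1] (mod p)"
    proof -
      have "(2::nat) ^ (2 * m) = (2 ^ m - 1) * p + 1"
        by (simp add: p_def power_mult power2_eq_square algebra_simps power_add flip: mult_2)
      then show ?thesis
        unfolding cong_def by (simp only: mod_mult_self3)
    qed
    have even_pow: "[2 ^ (2 * m * i) = 1] (mod p)" for i
      using cong_pow[OF sq, of i] by (simp add: power_mult)
    have "p dvd 2 ^ l - 1"
      using cong_to_1_nat[OF even_pow[of i]] unfolding i .
    moreover have "[2 ^ k + 1 = 1 * 2 ^ m + 1] (mod p)"
      unfolding j power_add by (intro cong_add cong_mult even_pow cong_refl)
    then have "p dvd 2 ^ k + 1"
      by (simp add: cong_dvd_iff p_def)
    ultimately have "is_unit p"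
      using assms(2) by (meson coprime_common_divisor)
    then show False
      by (simp add: p_def)
  qed
qed

theorem corollary9p2:
  fixes k l m q Q u v :: nat
    and a b d e :: "'a::finite_field"
    and A f :: "'a poly"
  assumes "k > 0" and "l > 0"
    and "m = 2 ^ multiplicity 2 (gcd k l)"
    and "q = 2 ^ k" and "Q = 2 ^ l"
    and "gcd (Q - 1) (q + 1) = 1"
    and "CARD('a) = q ^ 2"
    and "u > 0" and "v > 0"
    and "[u * (Q - 1) = q] (mod (q + 1))"
    and "[v * (Q - 1) = Q] (mod (q + 1))"
    and "A = 1 + monom b 1 + monom a v + monom d u"
    and "f = monom 1 1 * pcompose A (monom 1 (q - 1))"
    and "e = 1 + a ^ (q + 1) + b ^ (q + 1) + d ^ (q + 1)"
  shows "permutation_poly f \<longleftrightarrow>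
           e \<noteq> 0 \<and>
           (a * b ^ q + d ^ q) ^ Q = e ^ (Q - 1) * (a + b * d ^ q) \<and>
           finite_field_trace (2 ^ m) (k div m) ((a ^ (q + 1) + d ^ (q + 1)) / e) = 0"
proof -
  interpret F: binary_quadrinomial k l "TYPE('a)" a b d
    by unfold_locales (use assms in auto)
  have cop: "coprime (2 ^ l - 1) ((2::nat) ^ k + 1)"
    using assms(6) unfolding assms(4,5) coprime_iff_gcd_eq_1 .
  note odd = odd_quotient_of_coprime[OF assms(1) cop assms(3)]
  have "permutation_poly f \<longleftrightarrow> F.separating"
    using assms(4,5,10-13) by (intro F.permutation_iff_separating[OF cop, of u v]) simp_all
  also have "\<dots> \<longleftrightarrow> F.e \<noteq> 0 \<and> F.fr F.h = F.e ^ (2 ^ l - 1) * F.g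
      \<and> finite_field_trace (2 ^ m) (k div m) (F.n / F.e) = 0"
    using odd by (intro F.separating_iff[of m "k div m" "l div m"]) simp_all
  also have "F.e = e"
    using assms(4,14) by (simp add: F.e_def F.cj_def)
  also have "F.n = a ^ (q + 1) + d ^ (q + 1)"
    using assms(4) by (simp add: F.n_def F.cj_def)
  also have "F.fr F.h = (a * b ^ q + d ^ q) ^ Q"
    using assms(4,5) by (simp add: F.h_def F.cj_def F.fr_def add.commute)
  also have "F.g = a + b * d ^ q"
    using assms(4) by (simp add: F.g_def F.cj_def)
  finally show ?thesis
    using assms(5) by simp
qed

end
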